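(* Let $\Omega\subset\mathbb{R}^n$ be a bounded open set with $C^2$ boundary, $m_0\in\mathcal{P}(\overline\Omega)$, $L$ satisfying (L1)–(L3) below, and $F,G:\overline\Omega\times\mathcal{P}(\overline\Omega)\to\mathbb{R}$ continuous. Suppose that $F$ and $G$ are strictly monotone. Let $\eta_1,\eta_2\in\mathcal{P}_{m_0}(\Gamma)$ be constrained MFG equilibria for $m_0$. Then $J_{\eta_1}=J_{\eta_2}$. Consequently, if $(u_1,m_1)$ and $(u_2,m_2)$ are mild solutions of the constrained MFG problem in $\overline\Omega$, then $u_1=u_2$.
   Context: (L1) $L\in C^1(\overline\Omega\times\mathbb{R}^n)$, $|D_xL(x,v)|\le C(1+|v|^2)$, $|D_vL(x,v)|\le C(1+|v|)$; (L2) $L(x,v)\ge c_1|v|^2-c_0$ with $c_1,c_0>0$; (L3) $v\mapsto L(x,v)$ convex. $\mathcal{P}(\overline\Omega)$ has the Kantorovich–Rubinstein distance. A function $H:\overline\Omega\times\mathcal{P}(\overline\Omega)\to\mathbb{R}$ is strictly monotone if $\int_{\overline\Omega}(H(x,\mu_1)-H(x,\mu_2))\,d(\mu_1-\mu_2)(x)\ge0$ for all $\mu_1,\mu_2\in\mathcal{P}(\overline\Omega)$, with equality if and only if $H(x,\mu_1)=H(x,\mu_2)$ for all $x\in\overline\Omega$. $\Gamma=\{\gamma\in AC(0,T;\mathbb{R}^n):\gamma(t)\in\overline\Omega\ \forall t\}$ (uniform metric), $\Gamma[x]=\{\gamma\in\Gamma:\gamma(0)=x\}$, $e_t(\gamma)=\gamma(t)$,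 $\mathcal{P}_{m_0}(\Gamma)=\{\eta: e_0\sharp\eta=m_0\}$, $m^\eta(t)=e_t\sharp\eta$, $J_\eta[\gamma]=\int_0^T[L(\gamma,\dot\gamma)+F(\gamma(t),m^\eta(t))]dt+G(\gamma(T),m^\eta(T))$ for $\gamma\in\Gamma$, $\Gamma^\eta[x]$ = minimizers of $J_\eta$ on $\Gamma[x]$. A constrained MFG equilibrium for $m_0$ is $\eta\in\mathcal{P}_{m_0}(\Gamma)$ with $\mathrm{supp}(\eta)\subseteq\bigcup_x\Gamma^\eta[x]$. A mild solution of the constrained MFG problem in $\overline\Omega$ is a pair $(u,m)\in C([0,T]\times\overline\Omega)\times C([0,T];\mathcal{P}(\overline\Omega))$ such that for some constrained MFG equilibrium $\eta$ for $m_0$, $m(t)=e_t\sharp\eta$ for all $t$ and $u(t,x)=\inf\{\int_t^T[L(\gamma(s),\dot\gamma(s))+F(\gamma(s),m(s))]ds+G(\gamma(T),m(T)):\gamma\in\Gamma,\gamma(t)=x\}$. *)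

theory Defs
  imports "HOL-Probability.Probability"
begin

definition C2_boundary :: "'a::euclidean_space set \<Rightarrow> bool" where
  "C2_boundary \<Omega> \<longleftrightarrow>
     (\<forall>x\<in>frontier \<Omega>. \<exists>r>0. \<exists>(\<psi>::'a \<Rightarrow> real) (g::'a \<Rightarrow> 'a) (H::'a \<Rightarrow> 'a \<Rightarrow> 'a).
        (\<forall>y\<in>ball x r. (\<psi> has_derivative (\<lambda>h. g y \<bullet> h)) (at y)) \<and>
        (\<forall>y\<in>ball x r. (g has_derivative H y) (at y)) \<and>
        (\<forall>v. continuous_on (ball x r) (\<lambda>y. H y v)) \<and>
        (\<forall>y\<in>ball x r. g y \<noteq> 0) \<and>
        \<Omega> \<inter> ball x r = {y\<in>ball x r. \<psi> y < 0})"

definition Pmeas :: "'a::euclidean_space set \<Rightarrow> 'a measure set" where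
  "Pmeas \<Omega> = {\<mu>. prob_space \<mu> \<and> sets \<mu> = sets (restrict_space borel (closure \<Omega>))}"

definition KR_dist :: "'a::euclidean_space set \<Rightarrow> 'a measure \<Rightarrow> 'a measure \<Rightarrow> real" where
  "KR_dist \<Omega> \<mu> \<nu> =
     (SUP f\<in>{f::'a \<Rightarrow> real. 1-lipschitz_on (closure \<Omega>) f}.
        (\<integral>x. f x \<partial>\<mu>) - (\<integral>x. f x \<partial>\<nu>))"

definition cont_on_OmegaP ::
  "'a::euclidean_space set \<Rightarrow> ('a \<Rightarrow> 'a measure \<Rightarrow> real) \<Rightarrow> bool" where
  "cont_on_OmegaP \<Omega> H \<longleftrightarrow>
     (\<forall>x\<in>closure \<Omega>. \<forall>\<mu>\<in>Pmeas \<Omega>. \<forall>\<epsilon>>0. \<exists>\<delta>>0. \<forall>y\<in>closure \<Omega>. \<forall>\<nu>\<in>Pmeas \<Omega>.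
        dist y x + KR_dist \<Omega> \<nu> \<mu> < \<delta> \<longrightarrow> \<bar>H y \<nu> - H x \<mu>\<bar> < \<epsilon>)"

definition strictly_monotone ::
  "'a::euclidean_space set \<Rightarrow> ('a \<Rightarrow> 'a measure \<Rightarrow> real) \<Rightarrow> bool" where
  "strictly_monotone \<Omega> H \<longleftrightarrow>
     (\<forall>\<mu>1\<in>Pmeas \<Omega>. \<forall>\<mu>2\<in>Pmeas \<Omega>.
        let I = (\<integral>x. H x \<mu>1 - H x \<mu>2 \<partial>\<mu>1) - (\<integral>x. H x \<mu>1 - H x \<mu>2 \<partial>\<mu>2) in
        I \<ge> 0 \<and> (I = 0 \<longleftrightarrow> (\<forall>x\<in>closure \<Omega>. H x \<mu>1 = H x \<mu>2)))"

definition Lagrangian_ok :: "'a::euclidean_space set \<Rightarrow> ('a \<Rightarrow> 'a \<Rightarrow> real) \<Rightarrow> bool" where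
  "Lagrangian_ok \<Omega> L \<longleftrightarrow>
     \<comment> \<open>(L1)\<close>
     (\<exists>(Lx::'a \<Rightarrow> 'a \<Rightarrow> 'a) (Lv::'a \<Rightarrow> 'a \<Rightarrow> 'a) C.
        continuous_on (closure \<Omega> \<times> UNIV) (\<lambda>(x,v). L x v) \<and>
        continuous_on (closure \<Omega> \<times> UNIV) (\<lambda>(x,v). Lx x v) \<and>
        continuous_on (closure \<Omega> \<times> UNIV) (\<lambda>(x,v). Lv x v) \<and>
        (\<forall>x\<in>\<Omega>. \<forall>v. ((\<lambda>(y,w). L y w) has_derivative
              (\<lambda>(h,k). Lx x v \<bullet> h + Lv x v \<bullet> k)) (at (x,v))) \<and>
        (\<forall>x\<in>closure \<Omega>. \<forall>v. norm (Lx x v) \<le> C * (1 + (norm v)\<^sup>2)) \<and>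
        (\<forall>x\<in>closure \<Omega>. \<forall>v. norm (Lv x v) \<le> C * (1 + norm v))) \<and>
     \<comment> \<open>(L2)\<close>
     (\<exists>c1 c0::real. c1 > 0 \<and> c0 > 0 \<and>
        (\<forall>x\<in>closure \<Omega>. \<forall>v. L x v \<ge> c1 * (norm v)\<^sup>2 - c0)) \<and>
     \<comment> \<open>(L3)\<close>
     (\<forall>x\<in>closure \<Omega>. convex_on UNIV (L x))"

definition abs_cont_on :: "real set \<Rightarrow> (real \<Rightarrow> 'a::real_normed_vector) \<Rightarrow> bool" where
  "abs_cont_on I \<gamma> \<longleftrightarrow>
     (\<forall>\<epsilon>>0. \<exists>\<delta>>0. \<forall>(n::nat) (a::nat \<Rightarrow> real) (b::nat \<Rightarrow> real).
        (\<forall>i<n. a i \<le> b i \<and> a i \<in> I \<and> b i \<in> I) \<and>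
        (\<forall>i<n. \<forall>j<n. i \<noteq> j \<longrightarrow> b i \<le> a j \<or> b j \<le> a i) \<and>
        (\<Sum>i<n. b i - a i) < \<delta> \<longrightarrow>
        (\<Sum>i<n. norm (\<gamma> (b i) - \<gamma> (a i))) < \<epsilon>)"

text \<open>Curves on [0,T]; represented canonically as functions on the real line that are
  constant outside [0,T], so that curves are determined by their values on [0,T].\<close>
definition Curves :: "'a::euclidean_space set \<Rightarrow> real \<Rightarrow> (real \<Rightarrow> 'a) set" where
  "Curves \<Omega> T = {\<gamma>. abs_cont_on {0..T} \<gamma> \<and> (\<forall>t\<in>{0..T}. \<gamma> t \<in> closure \<Omega>) \<and>
                    (\<forall>t. \<gamma> t = \<gamma> (max 0 (min T t)))}"

definition unif_dist :: "real \<Rightarrow> (real \<Rightarrow> 'a::euclidean_space) \<Rightarrow> (real \<Rightarrow> 'a) \<Rightarrow> real" where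
  "unif_dist T \<gamma>1 \<gamma>2 = (SUP t\<in>{0..T}. dist (\<gamma>1 t) (\<gamma>2 t))"

definition Curves_open :: "'a::euclidean_space set \<Rightarrow> real \<Rightarrow> (real \<Rightarrow> 'a) set set" where
  "Curves_open \<Omega> T = {U. U \<subseteq> Curves \<Omega> T \<and>
     (\<forall>\<gamma>\<in>U. \<exists>\<epsilon>>0. \<forall>\<gamma>'\<in>Curves \<Omega> T. unif_dist T \<gamma> \<gamma>' < \<epsilon> \<longrightarrow> \<gamma>' \<in> U)}"

definition Curves_borel :: "'a::euclidean_space set \<Rightarrow> real \<Rightarrow> (real \<Rightarrow> 'a) measure" where
  "Curves_borel \<Omega> T = sigma (Curves \<Omega> T) (Curves_open \<Omega> T)"

definition Pcurves :: "'a::euclidean_space set \<Rightarrow> real \<Rightarrow> (real \<Rightarrow> 'a) measure set" where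
  "Pcurves \<Omega> T = {\<eta>. prob_space \<eta> \<and> sets \<eta> = sets (Curves_borel \<Omega> T)}"

definition support_curves ::
  "'a::euclidean_space set \<Rightarrow> real \<Rightarrow> (real \<Rightarrow> 'a) measure \<Rightarrow> (real \<Rightarrow> 'a) set" where
  "support_curves \<Omega> T \<eta> = {\<gamma>\<in>Curves \<Omega> T. \<forall>\<epsilon>>0.
      emeasure \<eta> {\<gamma>'\<in>Curves \<Omega> T. unif_dist T \<gamma> \<gamma>' < \<epsilon>} > 0}"

definition mflow :: "'a::euclidean_space set \<Rightarrow> (real \<Rightarrow> 'a) measure \<Rightarrow> real \<Rightarrow> 'a measure" where
  "mflow \<Omega> \<eta> t = distr \<eta> (restrict_space borel (closure \<Omega>)) (\<lambda>\<gamma>. \<gamma> t)"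

definition Pm0curves ::
  "'a::euclidean_space set \<Rightarrow> real \<Rightarrow> 'a measure \<Rightarrow> (real \<Rightarrow> 'a) measure set" where
  "Pm0curves \<Omega> T m0 = {\<eta>\<in>Pcurves \<Omega> T. mflow \<Omega> \<eta> 0 = m0}"

text \<open>Integral over [a,b] in the extended reals: the integrand is bounded below,
  so a non-integrable integrand has integral +infinity.\<close>
definition eint :: "(real \<Rightarrow> real) \<Rightarrow> real \<Rightarrow> real \<Rightarrow> ereal" where
  "eint f a b = (if set_integrable lborel {a..b} f then ereal (LINT t:{a..b}|lborel. f t) else \<infinity>)"

definition cost_from ::
  "('a::euclidean_space \<Rightarrow> 'a \<Rightarrow> real) \<Rightarrow> ('a \<Rightarrow> 'a measure \<Rightarrow> real) \<Rightarrow> ('a \<Rightarrow> 'a measure \<Rightarrow> real)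
   \<Rightarrow> real \<Rightarrow> (real \<Rightarrow> 'a measure) \<Rightarrow> real \<Rightarrow> (real \<Rightarrow> 'a) \<Rightarrow> ereal" where
  "cost_from L F G T m t \<gamma> =
     eint (\<lambda>s. L (\<gamma> s) (vector_derivative \<gamma> (at s)) + F (\<gamma> s) (m s)) t T + ereal (G (\<gamma> T) (m T))"

definition Jcost ::
  "'a::euclidean_space set \<Rightarrow> ('a \<Rightarrow> 'a \<Rightarrow> real) \<Rightarrow> ('a \<Rightarrow> 'a measure \<Rightarrow> real) \<Rightarrow> ('a \<Rightarrow> 'a measure \<Rightarrow> real)
   \<Rightarrow> real \<Rightarrow> (real \<Rightarrow> 'a) measure \<Rightarrow> (real \<Rightarrow> 'a) \<Rightarrow> ereal" where
  "Jcost \<Omega> L F G T \<eta> \<gamma> = cost_from L F G T (mflow \<Omega> \<eta>) 0 \<gamma>"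

definition optimal_curves ::
  "'a::euclidean_space set \<Rightarrow> ('a \<Rightarrow> 'a \<Rightarrow> real) \<Rightarrow> ('a \<Rightarrow> 'a measure \<Rightarrow> real) \<Rightarrow> ('a \<Rightarrow> 'a measure \<Rightarrow> real)
   \<Rightarrow> real \<Rightarrow> (real \<Rightarrow> 'a) measure \<Rightarrow> 'a \<Rightarrow> (real \<Rightarrow> 'a) set" where
  "optimal_curves \<Omega> L F G T \<eta> x = {\<gamma>\<in>Curves \<Omega> T. \<gamma> 0 = x \<and>
      (\<forall>\<gamma>'\<in>Curves \<Omega> T. \<gamma>' 0 = x \<longrightarrow> Jcost \<Omega> L F G T \<eta> \<gamma> \<le> Jcost \<Omega> L F G T \<eta> \<gamma>')}"

definition MFG_equilibrium ::
  "'a::euclidean_space set \<Rightarrow> ('a \<Rightarrow> 'a \<Rightarrow> real) \<Rightarrow> ('a \<Rightarrow> 'a measure \<Rightarrow> real) \<Rightarrow> ('a \<Rightarrow> 'a measure \<Rightarrow> real)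
   \<Rightarrow> real \<Rightarrow> 'a measure \<Rightarrow> (real \<Rightarrow> 'a) measure \<Rightarrow> bool" where
  "MFG_equilibrium \<Omega> L F G T m0 \<eta> \<longleftrightarrow>
     \<eta> \<in> Pm0curves \<Omega> T m0 \<and>
     support_curves \<Omega> T \<eta> \<subseteq> (\<Union>x\<in>closure \<Omega>. optimal_curves \<Omega> L F G T \<eta> x)"

definition mild_solution ::
  "'a::euclidean_space set \<Rightarrow> ('a \<Rightarrow> 'a \<Rightarrow> real) \<Rightarrow> ('a \<Rightarrow> 'a measure \<Rightarrow> real) \<Rightarrow> ('a \<Rightarrow> 'a measure \<Rightarrow> real)
   \<Rightarrow> real \<Rightarrow> 'a measure \<Rightarrow> (real \<Rightarrow> 'a \<Rightarrow> real) \<Rightarrow> (real \<Rightarrow> 'a measure) \<Rightarrow> bool" where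
  "mild_solution \<Omega> L F G T m0 u m \<longleftrightarrow>
     continuous_on ({0..T} \<times> closure \<Omega>) (\<lambda>(t,x). u t x) \<and>
     (\<forall>t\<in>{0..T}. m t \<in> Pmeas \<Omega>) \<and>
     (\<forall>t\<in>{0..T}. ((\<lambda>s. KR_dist \<Omega> (m s) (m t)) \<longlongrightarrow> 0) (at t within {0..T})) \<and>
     (\<exists>\<eta>. MFG_equilibrium \<Omega> L F G T m0 \<eta> \<and>
        (\<forall>t\<in>{0..T}. m t = mflow \<Omega> \<eta> t) \<and>
        (\<forall>t\<in>{0..T}. \<forall>x\<in>closure \<Omega>.
           ereal (u t x) = (INF \<gamma>\<in>{\<gamma>\<in>Curves \<Omega> T. \<gamma> t = x}. cost_from L F G T m t \<gamma>)))"

end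

theory Submission
  imports Defs "HOL-Complex_Analysis.Great_Picard"
begin

text \<open>
  Let D be the difference of the two cost functionals. The Lagrangian cancels, so D is bounded and
  continuous on curves. If \<open>\<gamma>\<^sub>1\<close> and \<open>\<gamma>\<^sub>2\<close> have the same starting point and are optimal for the first and
  for the second equilibrium, testing the optimality of each with the other gives \<open>D \<gamma>\<^sub>1 \<le> D \<gamma>\<^sub>2\<close>.
  Both equilibria have initial law \<open>m\<^sub>0\<close>, so \<open>\<integral>D d\<eta>\<^sub>1 \<le> \<integral>D d\<eta>\<^sub>2\<close> as soon as a Borel function of the
  starting point separates the two sides; the supremum of D over a countable union of compact sets of
  curves that carries \<open>\<eta>\<^sub>1\<close> is such a function. By Fubini, the difference of the two integrals is the time
  integral of the monotonicity gaps of F plus the gap of G. All gaps are nonnegative and the gap of F is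
  continuous in time, so they vanish, and strict monotonicity identifies the couplings.
\<close>

section \<open>Dominated convergence and set integrability\<close>

text \<open>Dominated convergence along sequences of parameters. The majorant is the constant
  \<open>B\<close>, which is integrable because \<open>M\<close> has mass 1.\<close>

lemma continuous_on_integral_param:
  fixes f :: "'p::metric_space \<Rightarrow> 'b \<Rightarrow> real"
  assumes "prob_space M"
    and meas: "\<And>t. t \<in> S \<Longrightarrow> f t \<in> borel_measurable M"
    and bnd: "\<And>t x. t \<in> S \<Longrightarrow> x \<in> space M \<Longrightarrow> \<bar>f t x\<bar> \<le> B"
    and cont: "\<And>x. x \<in> space M \<Longrightarrow> continuous_on S (\<lambda>t. f t x)"
  shows "continuous_on S (\<lambda>t. \<integral>x. f t x \<partial>M)"
  unfolding continuous_on_sequentially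
proof (intro allI ballI impI)
  fix X :: "nat \<Rightarrow> 'p" and a
  assume a: "a \<in> S" and X: "(\<forall>n. X n \<in> S) \<and> X \<longlonglongrightarrow> a"
  interpret prob_space M by fact
  have "(\<lambda>n. \<integral>x. f (X n) x \<partial>M) \<longlonglongrightarrow> (\<integral>x. f a x \<partial>M)"
  proof (rule integral_dominated_convergence[where w = "\<lambda>_. B"])
    show "AE x in M. (\<lambda>i. f (X i) x) \<longlonglongrightarrow> f a x"
      using cont X a by (intro AE_I2) (auto simp: continuous_on_sequentially o_def)
  qed (use X a meas bnd in auto)
  then show "((\<lambda>t. \<integral>x. f t x \<partial>M) \<circ> X) \<longlonglongrightarrow> (\<integral>x. f a x \<partial>M)"
    by (simp add: o_def)
qed

text \<open>Ensures that \<open>eint\<close> takes the same branch with and without the coupling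
  term, so that only the Lagrangian decides whether a cost is infinite.\<close>

lemma set_integrable_add_iff:
  fixes f g :: "'b \<Rightarrow> real"
  assumes "set_integrable M A g"
  shows "set_integrable M A (\<lambda>x. f x + g x) \<longleftrightarrow> set_integrable M A f"
proof
  assume "set_integrable M A (\<lambda>x. f x + g x)"
  from set_integral_diff(1)[OF this assms] show "set_integrable M A f"
    by simp
qed (use set_integral_add(1) assms in blast)

section \<open>Curves in the closed domain and the uniform distance\<close>

locale curve_space =
  fixes \<Omega> :: "'a::euclidean_space set" and T :: real
  assumes bounded_domain: "bounded \<Omega>" and T_pos: "0 < T"
begin

lemma compact_closure_domain: "compact (closure \<Omega>)"
  using bounded_domain compact_closure by blast

lemma clamp_mem: "max 0 (min T t) \<in> {0..T}"
  using T_pos by auto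

lemma clamp_id: "t \<in> {0..T} \<Longrightarrow> max 0 (min T t) = t"
  by auto

lemma curve_clamp: "\<gamma> \<in> Curves \<Omega> T \<Longrightarrow> \<gamma> t = \<gamma> (max 0 (min T t))"
  by (simp add: Curves_def)

lemma curve_mem: "\<gamma> \<in> Curves \<Omega> T \<Longrightarrow> \<gamma> t \<in> closure \<Omega>"
  using curve_clamp[of \<gamma> t] clamp_mem[of t] unfolding Curves_def by (smt (verit, best) mem_Collect_eq)

text \<open>Absolute continuity tested on a single interval is continuity on [0,T]. The clamping
  built into \<open>Curves\<close> then extends it to the whole line.\<close>

lemma curve_continuous:
  assumes "\<gamma> \<in> Curves \<Omega> T"
  shows "continuous_on S \<gamma>"
proof -
  have ac: "abs_cont_on {0..T} \<gamma>"
    using assms by (simp add: Curves_def)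
  have "continuous_on {0..T} \<gamma>"
    unfolding continuous_on_iff
  proof (intro ballI allI impI)
    fix x e :: real assume x: "x \<in> {0..T}" and "0 < e"
    obtain d where "d > 0" and d: "\<forall>(n::nat) a b.
        (\<forall>i<n. a i \<le> b i \<and> a i \<in> {0..T} \<and> b i \<in> {0..T}) \<and>
        (\<forall>i<n. \<forall>j<n. i \<noteq> j \<longrightarrow> b i \<le> a j \<or> b j \<le> a i) \<and>
        (\<Sum>i<n. b i - a i) < d \<longrightarrow> (\<Sum>i<n. norm (\<gamma> (b i) - \<gamma> (a i))) < e"
      using ac \<open>0 < e\<close> unfolding abs_cont_on_def by blast
    have "dist (\<gamma> y) (\<gamma> x) < e" if "y \<in> {0..T}" "dist y x < d" for y
      \<comment> \<open>A family of one interval; \<open>min\<close> and \<open>max\<close> put its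
        endpoints in the order that \<open>abs_cont_on\<close> demands.\<close>
      using d[THEN spec[of _ 1], THEN spec[of _ "\<lambda>_. min x y"], THEN spec[of _ "\<lambda>_. max x y"]] that x
      by (auto simp: dist_norm min_def max_def norm_minus_commute abs_real_def split: if_splits)
    then show "\<exists>d>0. \<forall>x'\<in>{0..T}. dist x' x < d \<longrightarrow> dist (\<gamma> x') (\<gamma> x) < e"
      using \<open>d > 0\<close> by blast
  qed
  then have "continuous_on UNIV (\<lambda>t. \<gamma> (max 0 (min T t)))"
    by (rule continuous_on_compose2) (use T_pos in \<open>auto intro!: continuous_intros\<close>)
  moreover have "(\<lambda>t. \<gamma> (max 0 (min T t))) = \<gamma>"
    using curve_clamp[OF assms, symmetric] by (rule ext)
  ultimately have "continuous_on UNIV \<gamma>"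
    by (simp only:)
  then show ?thesis
    using continuous_on_subset by blast
qed

lemma const_curve: "x \<in> closure \<Omega> \<Longrightarrow> (\<lambda>_. x) \<in> Curves \<Omega> T"
  unfolding Curves_def abs_cont_on_def by (auto intro: exI[of _ 1])

text \<open>The supremum in \<open>unif_dist\<close> is taken in the reals and dominates its members
  only once it is known to be bounded. Boundedness of the domain provides this.\<close>

lemma bdd_above_dist:
  assumes "\<gamma> \<in> Curves \<Omega> T" "\<gamma>' \<in> Curves \<Omega> T"
  shows "bdd_above ((\<lambda>t. dist (\<gamma> t) (\<gamma>' t)) ` {0..T})"
proof -
  have "bounded (closure \<Omega>)"
    using bounded_domain by (rule bounded_closure)
  then show ?thesis
    using curve_mem[OF assms(1)] curve_mem[OF assms(2)]
    by (auto intro!: bdd_aboveI2[where M = "diameter (closure \<Omega>)"] diameter_bounded_bound)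
qed

lemma dist_le_unif_dist:
  assumes "\<gamma> \<in> Curves \<Omega> T" "\<gamma>' \<in> Curves \<Omega> T"
  shows "dist (\<gamma> t) (\<gamma>' t) \<le> unif_dist T \<gamma> \<gamma>'"
proof -
  have "dist (\<gamma> t) (\<gamma>' t) = dist (\<gamma> (max 0 (min T t))) (\<gamma>' (max 0 (min T t)))"
    using curve_clamp[OF assms(1), of t] curve_clamp[OF assms(2), of t] by (simp only:)
  also have "\<dots> \<le> unif_dist T \<gamma> \<gamma>'"
    unfolding unif_dist_def by (rule cSUP_upper[OF clamp_mem bdd_above_dist[OF assms]])
  finally show ?thesis .
qed

lemma unif_dist_nonneg: "\<gamma> \<in> Curves \<Omega> T \<Longrightarrow> \<gamma>' \<in> Curves \<Omega> T \<Longrightarrow> 0 \<le> unif_dist T \<gamma> \<gamma>'"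
  by (rule order_trans[OF zero_le_dist dist_le_unif_dist])

lemma unif_dist_le: "(\<And>t. t \<in> {0..T} \<Longrightarrow> dist (\<gamma> t) (\<gamma>' t) \<le> e) \<Longrightarrow> unif_dist T \<gamma> \<gamma>' \<le> e"
  unfolding unif_dist_def using T_pos by (intro cSUP_least) auto

lemma unif_dist_triangle:
  assumes "\<gamma> \<in> Curves \<Omega> T" "\<gamma>' \<in> Curves \<Omega> T" "\<gamma>'' \<in> Curves \<Omega> T"
  shows "unif_dist T \<gamma> \<gamma>'' \<le> unif_dist T \<gamma> \<gamma>' + unif_dist T \<gamma>' \<gamma>''"
proof (rule unif_dist_le)
  fix t
  show "dist (\<gamma> t) (\<gamma>'' t) \<le> unif_dist T \<gamma> \<gamma>' + unif_dist T \<gamma>' \<gamma>''"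
    using dist_triangle[of "\<gamma> t" "\<gamma>'' t" "\<gamma>' t"] dist_le_unif_dist[OF assms(1,2), of t]
      dist_le_unif_dist[OF assms(2,3), of t] by linarith
qed

lemma unif_dist_tendsto:
  assumes "\<And>n. X n \<in> Curves \<Omega> T" "\<gamma> \<in> Curves \<Omega> T" "(\<lambda>n. unif_dist T \<gamma> (X n)) \<longlonglongrightarrow> 0"
  shows "(\<lambda>n. X n t) \<longlonglongrightarrow> \<gamma> t"
proof -
  have "(\<lambda>n. dist (X n t) (\<gamma> t)) \<longlonglongrightarrow> 0"
  proof (rule Lim_null_comparison[OF always_eventually assms(3)], rule allI)
    fix n
    show "norm (dist (X n t) (\<gamma> t)) \<le> unif_dist T \<gamma> (X n)"
      using dist_le_unif_dist[OF assms(2,1), of t n] by (simp add: dist_commute)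
  qed
  then show ?thesis
    by (rule iffD2[OF tendsto_dist_iff])
qed

section \<open>Closed sets of curves and the Borel structure\<close>

text \<open>Closedness is phrased with sequences because the sets that matter (oscillation bounds,
  superlevel sets of a continuous functional, supports) are closed by passing to limits.\<close>

definition uclosed :: "(real \<Rightarrow> 'a) set \<Rightarrow> bool" where
  "uclosed A \<longleftrightarrow> A \<subseteq> Curves \<Omega> T \<and>
    (\<forall>X \<gamma>. (\<forall>n. X n \<in> A) \<longrightarrow> \<gamma> \<in> Curves \<Omega> T \<longrightarrow> (\<lambda>n. unif_dist T \<gamma> (X n)) \<longlonglongrightarrow> 0 \<longrightarrow> \<gamma> \<in> A)"

lemma uclosedI:
  assumes "A \<subseteq> Curves \<Omega> T"
    and "\<And>X \<gamma>. (\<And>n. X n \<in> A) \<Longrightarrow> \<gamma> \<in> Curves \<Omega> T \<Longrightarrow> (\<lambda>n. unif_dist T \<gamma> (X n)) \<longlonglongrightarrow> 0 \<Longrightarrow> \<gamma> \<in> A"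
  shows "uclosed A"
  using assms by (auto simp: uclosed_def)

lemma uclosedD:
  "uclosed A \<Longrightarrow> (\<And>n. X n \<in> A) \<Longrightarrow> \<gamma> \<in> Curves \<Omega> T \<Longrightarrow> (\<lambda>n. unif_dist T \<gamma> (X n)) \<longlonglongrightarrow> 0 \<Longrightarrow> \<gamma> \<in> A"
  by (auto simp: uclosed_def)

lemma uclosed_subset: "uclosed A \<Longrightarrow> A \<subseteq> Curves \<Omega> T"
  by (simp add: uclosed_def)

lemma uclosed_Int: "uclosed A \<Longrightarrow> uclosed B \<Longrightarrow> uclosed (A \<inter> B)"
  by (rule uclosedI) (use uclosed_subset uclosedD[of A] uclosedD[of B] in \<open>blast+\<close>)

lemma space_Curves_borel: "space (Curves_borel \<Omega> T) = Curves \<Omega> T"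
  unfolding Curves_borel_def by (rule space_measure_of) (auto simp: Curves_open_def)

lemma Curves_open_sets: "U \<in> Curves_open \<Omega> T \<Longrightarrow> U \<in> sets (Curves_borel \<Omega> T)"
  unfolding Curves_borel_def by (rule in_measure_of) (auto simp: Curves_open_def)

text \<open>If the complement were not open at some curve, balls of radius 1/(n+1) around that curve
  would yield a sequence in \<open>A\<close> converging to it.\<close>

lemma uclosed_sets:
  assumes "uclosed A"
  shows "A \<in> sets (Curves_borel \<Omega> T)"
proof -
  have "Curves \<Omega> T - A \<in> Curves_open \<Omega> T"
  proof (rule ccontr)
    assume "Curves \<Omega> T - A \<notin> Curves_open \<Omega> T"
    then obtain \<gamma> where \<gamma>: "\<gamma> \<in> Curves \<Omega> T" "\<gamma> \<notin> A"
      and *: "\<And>e. e > 0 \<Longrightarrow> \<exists>\<gamma>'\<in>Curves \<Omega> T. unif_dist T \<gamma> \<gamma>' < e \<and> \<gamma>' \<in> A"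
      unfolding Curves_open_def by auto
    have "\<exists>\<gamma>'\<in>Curves \<Omega> T. unif_dist T \<gamma> \<gamma>' < 1 / real (Suc n) \<and> \<gamma>' \<in> A" for n
      by (rule *) simp
    then obtain X where X: "\<And>n. X n \<in> Curves \<Omega> T" "\<And>n. unif_dist T \<gamma> (X n) < 1 / real (Suc n)" "\<And>n. X n \<in> A"
      by metis
    have "(\<lambda>n. unif_dist T \<gamma> (X n)) \<longlonglongrightarrow> 0"
    proof (rule Lim_null_comparison[OF always_eventually LIMSEQ_inverse_real_of_nat], rule allI)
      fix n
      show "norm (unif_dist T \<gamma> (X n)) \<le> inverse (real (Suc n))"
        using X(2)[of n] unif_dist_nonneg[OF \<gamma>(1) X(1), of n] by (simp add: inverse_eq_divide)
    qed
    then show False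
      using uclosedD[of A X, OF assms X(3) \<gamma>(1)] \<gamma>(2) by blast
  qed
  then have "space (Curves_borel \<Omega> T) - (Curves \<Omega> T - A) \<in> sets (Curves_borel \<Omega> T)"
    by (intro sets.compl_sets Curves_open_sets)
  moreover have "space (Curves_borel \<Omega> T) - (Curves \<Omega> T - A) = A"
    using uclosed_subset[OF assms] by (auto simp: space_Curves_borel)
  ultimately show ?thesis by simp
qed

lemma uball_sets:
  assumes "\<gamma> \<in> Curves \<Omega> T"
  shows "{\<gamma>'\<in>Curves \<Omega> T. unif_dist T \<gamma> \<gamma>' < e} \<in> sets (Curves_borel \<Omega> T)"
proof (rule Curves_open_sets, unfold Curves_open_def, safe)
  fix \<gamma>' assume \<gamma>': "\<gamma>' \<in> Curves \<Omega> T" "unif_dist T \<gamma> \<gamma>' < e"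
  show "\<exists>\<epsilon>>0. \<forall>\<gamma>''\<in>Curves \<Omega> T. unif_dist T \<gamma>' \<gamma>'' < \<epsilon> \<longrightarrow> \<gamma>'' \<in> {\<gamma>'\<in>Curves \<Omega> T. unif_dist T \<gamma> \<gamma>' < e}"
  proof (intro exI[of _ "e - unif_dist T \<gamma> \<gamma>'"] conjI ballI impI)
    fix \<gamma>'' assume "\<gamma>'' \<in> Curves \<Omega> T" "unif_dist T \<gamma>' \<gamma>'' < e - unif_dist T \<gamma> \<gamma>'"
    then show "\<gamma>'' \<in> {\<gamma>'\<in>Curves \<Omega> T. unif_dist T \<gamma> \<gamma>' < e}"
      using unif_dist_triangle[OF assms \<gamma>'(1), of \<gamma>''] by auto
  qed (use \<gamma>' in auto)
qed

text \<open>Evaluation at a fixed time is 1-Lipschitz for \<open>unif_dist\<close>, so preimages of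
  open sets are open.\<close>

lemma eval_measurable: "(\<lambda>\<gamma>. \<gamma> t) \<in> Curves_borel \<Omega> T \<rightarrow>\<^sub>M restrict_space borel (closure \<Omega>)"
proof (rule measurable_restrict_space2)
  show "(\<lambda>\<gamma>. \<gamma> t) \<in> borel_measurable (Curves_borel \<Omega> T)"
  proof (rule borel_measurableI)
    fix U :: "'a set" assume "open U"
    have "(\<lambda>\<gamma>. \<gamma> t) -` U \<inter> Curves \<Omega> T \<in> Curves_open \<Omega> T"
      unfolding Curves_open_def
    proof safe
      fix \<gamma> assume \<gamma>: "\<gamma> t \<in> U" "\<gamma> \<in> Curves \<Omega> T"
      obtain e where e: "e > 0" "\<And>y. dist y (\<gamma> t) < e \<Longrightarrow> y \<in> U"
        using \<open>open U\<close> \<gamma>(1) unfolding open_dist by blast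
      have "\<gamma>' t \<in> U" if "\<gamma>' \<in> Curves \<Omega> T" "unif_dist T \<gamma> \<gamma>' < e" for \<gamma>'
        using that dist_le_unif_dist[OF \<gamma>(2) that(1), of t] by (intro e(2)) (simp add: dist_commute)
      then show "\<exists>\<epsilon>>0. \<forall>\<gamma>'\<in>Curves \<Omega> T. unif_dist T \<gamma> \<gamma>' < \<epsilon> \<longrightarrow> \<gamma>' \<in> (\<lambda>\<gamma>. \<gamma> t) -` U \<inter> Curves \<Omega> T"
        using e(1) by blast
    qed
    then show "(\<lambda>\<gamma>. \<gamma> t) -` U \<inter> space (Curves_borel \<Omega> T) \<in> sets (Curves_borel \<Omega> T)"
      by (simp add: space_Curves_borel Curves_open_sets)
  qed
qed (auto simp: space_Curves_borel curve_mem)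

section \<open>Probability measures on curves and their time marginals\<close>

lemma Pcurves_space: "\<eta> \<in> Pcurves \<Omega> T \<Longrightarrow> space \<eta> = Curves \<Omega> T"
  unfolding Pcurves_def using sets_eq_imp_space_eq space_Curves_borel by blast

lemma Pcurves_prob: "\<eta> \<in> Pcurves \<Omega> T \<Longrightarrow> prob_space \<eta>"
  by (simp add: Pcurves_def)

lemma Pcurves_sets: "\<eta> \<in> Pcurves \<Omega> T \<Longrightarrow> sets \<eta> = sets (Curves_borel \<Omega> T)"
  by (simp add: Pcurves_def)

lemma eval_measurable_Pcurves:
  assumes "\<eta> \<in> Pcurves \<Omega> T"
  shows "(\<lambda>\<gamma>. \<gamma> t) \<in> \<eta> \<rightarrow>\<^sub>M restrict_space borel (closure \<Omega>)" "(\<lambda>\<gamma>. \<gamma> t) \<in> borel_measurable \<eta>"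
  using eval_measurable[of t]
  unfolding measurable_cong_sets[OF Pcurves_sets[OF assms] refl] measurable_restrict_space2_iff
  by blast+

lemma mflow_Pmeas: "\<eta> \<in> Pcurves \<Omega> T \<Longrightarrow> mflow \<Omega> \<eta> t \<in> Pmeas \<Omega>"
  unfolding Pmeas_def mflow_def
  using prob_space.prob_space_distr[OF Pcurves_prob eval_measurable_Pcurves(1)] by simp

lemma mflow_integral:
  fixes f :: "'a \<Rightarrow> real"
  assumes "\<eta> \<in> Pcurves \<Omega> T" "continuous_on (closure \<Omega>) f"
  shows "(\<integral>x. f x \<partial>mflow \<Omega> \<eta> t) = (\<integral>\<gamma>. f (\<gamma> t) \<partial>\<eta>)"
  unfolding mflow_def
  by (rule integral_distr[OF eval_measurable_Pcurves(1)[OF assms(1)]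
        borel_measurable_continuous_on_restrict[OF assms(2)]])

lemma continuous_eval_measurable:
  fixes f :: "'a \<Rightarrow> real"
  assumes "\<eta> \<in> Pcurves \<Omega> T" "continuous_on (closure \<Omega>) f"
  shows "(\<lambda>\<gamma>. f (\<gamma> t)) \<in> borel_measurable \<eta>"
  by (rule measurable_compose[OF eval_measurable_Pcurves(1)[OF assms(1)]
        borel_measurable_continuous_on_restrict[OF assms(2)]])

lemma continuous_eval_integrable:
  fixes f :: "'a \<Rightarrow> real"
  assumes "\<eta> \<in> Pcurves \<Omega> T" "continuous_on (closure \<Omega>) f"
  shows "integrable \<eta> (\<lambda>\<gamma>. f (\<gamma> t))"
proof -
  interpret prob_space \<eta> using Pcurves_prob assms(1) .
  have "bounded (f ` closure \<Omega>)"
    using compact_continuous_image[OF assms(2) compact_closure_domain] compact_imp_bounded by blast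
  then obtain B where "\<And>x. x \<in> closure \<Omega> \<Longrightarrow> norm (f x) \<le> B"
    unfolding bounded_iff by blast
  then show ?thesis
    using continuous_eval_measurable[OF assms] curve_mem Pcurves_space[OF assms(1)]
    by (intro integrable_const_bound[of _ B] AE_I2) auto
qed

text \<open>The joint law of the positions at times s and t is a coupling of the two marginals. Its
  transport cost dominates the difference of the integrals of every 1-Lipschitz test
  function.\<close>

lemma KR_dist_mflow_le:
  assumes "\<eta> \<in> Pcurves \<Omega> T"
  shows "KR_dist \<Omega> (mflow \<Omega> \<eta> s) (mflow \<Omega> \<eta> t) \<le> (\<integral>\<gamma>. dist (\<gamma> s) (\<gamma> t) \<partial>\<eta>)"
  unfolding KR_dist_def
proof (rule cSUP_least)
  have "1-lipschitz_on (closure \<Omega>) (\<lambda>_::'a. 0::real)"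
    by (simp add: lipschitz_on_def)
  then show "{f::'a \<Rightarrow> real. 1-lipschitz_on (closure \<Omega>) f} \<noteq> {}"
    by blast
next
  fix f :: "'a \<Rightarrow> real" assume "f \<in> {f. 1-lipschitz_on (closure \<Omega>) f}"
  then have f: "1-lipschitz_on (closure \<Omega>) f" and cf: "continuous_on (closure \<Omega>) f"
    using lipschitz_on_continuous_on by auto
  interpret prob_space \<eta> using Pcurves_prob assms .
  have [measurable]: "(\<lambda>\<gamma>. \<gamma> t) \<in> borel_measurable \<eta>" "(\<lambda>\<gamma>. \<gamma> s) \<in> borel_measurable \<eta>"
    using eval_measurable_Pcurves(2)[OF assms] by auto
  have "bounded (closure \<Omega>)"
    using bounded_domain by (rule bounded_closure)
  then have i: "integrable \<eta> (\<lambda>\<gamma>. dist (\<gamma> s) (\<gamma> t))"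
    by (intro integrable_const_bound[of _ "diameter (closure \<Omega>)"] AE_I2)
      (auto simp: Pcurves_space[OF assms] curve_mem diameter_bounded_bound)
  have "(\<integral>x. f x \<partial>mflow \<Omega> \<eta> s) - (\<integral>x. f x \<partial>mflow \<Omega> \<eta> t) = (\<integral>\<gamma>. f (\<gamma> s) - f (\<gamma> t) \<partial>\<eta>)"
    using mflow_integral[OF assms cf] continuous_eval_integrable[OF assms cf] by simp
  also have "\<dots> \<le> (\<integral>\<gamma>. dist (\<gamma> s) (\<gamma> t) \<partial>\<eta>)"
  proof (rule integral_mono)
    fix \<gamma> assume "\<gamma> \<in> space \<eta>"
    then have "dist (f (\<gamma> s)) (f (\<gamma> t)) \<le> 1 * dist (\<gamma> s) (\<gamma> t)"
      using curve_mem by (intro lipschitz_onD[OF f]) (auto simp: Pcurves_space[OF assms])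
    then show "f (\<gamma> s) - f (\<gamma> t) \<le> dist (\<gamma> s) (\<gamma> t)"
      by (simp add: dist_real_def)
  qed (use i continuous_eval_integrable[OF assms cf] in auto)
  finally show "(\<integral>x. f x \<partial>mflow \<Omega> \<eta> s) - (\<integral>x. f x \<partial>mflow \<Omega> \<eta> t) \<le> (\<integral>\<gamma>. dist (\<gamma> s) (\<gamma> t) \<partial>\<eta>)" .
qed

text \<open>The mean displacement between times s and t is continuous in s by dominated convergence
  and vanishes at s = t. It controls the Kantorovich-Rubinstein distance of the marginals, hence
  continuity of \<open>H\<close> transfers to (t,x).\<close>

lemma continuous_along_mflow:
  assumes \<eta>: "\<eta> \<in> Pcurves \<Omega> T" and H: "cont_on_OmegaP \<Omega> H"
  shows "continuous_on (UNIV \<times> closure \<Omega>) (\<lambda>(t,x). H x (mflow \<Omega> \<eta> t))"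
  unfolding continuous_on_iff
proof (intro ballI allI impI)
  fix p :: "real \<times> 'a" and e :: real assume p: "p \<in> UNIV \<times> closure \<Omega>" and "0 < e"
  obtain t x where tx: "p = (t,x)" by fastforce
  obtain d where "d > 0" and d: "\<And>y \<nu>. y \<in> closure \<Omega> \<Longrightarrow> \<nu> \<in> Pmeas \<Omega> \<Longrightarrow>
      dist y x + KR_dist \<Omega> \<nu> (mflow \<Omega> \<eta> t) < d \<Longrightarrow> \<bar>H y \<nu> - H x (mflow \<Omega> \<eta> t)\<bar> < e"
    using H p tx \<open>0 < e\<close> mflow_Pmeas[OF \<eta>] unfolding cont_on_OmegaP_def by (metis mem_Sigma_iff)
  have [measurable]: "(\<lambda>\<gamma>. \<gamma> s) \<in> borel_measurable \<eta>" for s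
    using eval_measurable_Pcurves(2)[OF \<eta>] by auto
  have "continuous_on UNIV (\<lambda>s. \<integral>\<gamma>. dist (\<gamma> s) (\<gamma> t) \<partial>\<eta>)"
    by (rule continuous_on_integral_param[OF Pcurves_prob[OF \<eta>], where B = "diameter (closure \<Omega>)"])
      (auto simp: Pcurves_space[OF \<eta>] curve_mem diameter_bounded_bound bounded_closure[OF bounded_domain]
        intro!: continuous_intros curve_continuous)
  then obtain d' where d': "d' > 0" "\<And>s. dist s t < d' \<Longrightarrow> (\<integral>\<gamma>. dist (\<gamma> s) (\<gamma> t) \<partial>\<eta>) < d / 2"
    using \<open>d > 0\<close> unfolding continuous_on_iff
    by (drule_tac bspec[of _ _ t], simp, drule_tac spec[of _ "d/2"]) (force simp: dist_real_def)
  show "\<exists>\<delta>>0. \<forall>q\<in>UNIV \<times> closure \<Omega>. dist q p < \<delta> \<longrightarrow>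
      dist (case q of (t,x) \<Rightarrow> H x (mflow \<Omega> \<eta> t)) (case p of (t,x) \<Rightarrow> H x (mflow \<Omega> \<eta> t)) < e"
  \<comment> \<open>Half of the allowance \<open>d\<close> goes to the displacement in space, the
    other half to the distance of the marginals.\<close>
  proof (intro exI[of _ "min d' (d/2)"] conjI ballI impI)
    fix q assume q: "q \<in> UNIV \<times> closure \<Omega>" "dist q p < min d' (d/2)"
    obtain s y where sy: "q = (s,y)" by fastforce
    have "dist s t < d'" "dist y x < d / 2"
      using q dist_fst_le[of q p] dist_snd_le[of q p] tx sy by auto
    then have "dist y x + KR_dist \<Omega> (mflow \<Omega> \<eta> s) (mflow \<Omega> \<eta> t) < d"
      using KR_dist_mflow_le[OF \<eta>, of s t] d'(2)[of s] by simp
    then show "dist (case q of (t,x) \<Rightarrow> H x (mflow \<Omega> \<eta> t)) (case p of (t,x) \<Rightarrow> H x (mflow \<Omega> \<eta> t)) < e"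
      using d[of y "mflow \<Omega> \<eta> s"] mflow_Pmeas[OF \<eta>] q sy tx by (auto simp: dist_real_def)
  qed (use d' \<open>d > 0\<close> in auto)
qed

section \<open>Tightness through common moduli of absolute continuity\<close>

definition subintervals :: "nat \<Rightarrow> (nat \<Rightarrow> real) \<Rightarrow> (nat \<Rightarrow> real) \<Rightarrow> bool" where
  "subintervals n a b \<longleftrightarrow>
    (\<forall>i<n. a i \<le> b i \<and> a i \<in> {0..T} \<and> b i \<in> {0..T}) \<and>
    (\<forall>i<n. \<forall>j<n. i \<noteq> j \<longrightarrow> b i \<le> a j \<or> b j \<le> a i)"

lemma abs_cont_on_subintervals:
  "abs_cont_on {0..T} \<gamma> \<longleftrightarrow> (\<forall>e>0. \<exists>d>0. \<forall>n a b. subintervals n a b \<and> (\<Sum>i<n. b i - a i) < d \<longrightarrow>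
    (\<Sum>i<n. norm (\<gamma> (b i) - \<gamma> (a i))) < e)"
  unfolding abs_cont_on_def subintervals_def by (simp only: conj_assoc)

text \<open>A single quantitative instance of absolute continuity: tolerance number k, threshold
  number j. The final inequality is not strict, so that it survives limits.\<close>

definition osc_set :: "nat \<Rightarrow> nat \<Rightarrow> (real \<Rightarrow> 'a) set" where
  "osc_set k j = {\<gamma>\<in>Curves \<Omega> T. \<forall>n a b. subintervals n a b \<and> (\<Sum>i<n. b i - a i) < 1 / real (Suc j) \<longrightarrow>
    (\<Sum>i<n. norm (\<gamma> (b i) - \<gamma> (a i))) \<le> 1 / real (Suc k)}"

lemma osc_set_mono:
  assumes "j \<le> j'"
  shows "osc_set k j \<subseteq> osc_set k j'"
proof -
  have "1 / real (Suc j') \<le> 1 / real (Suc j)"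
    using assms by (simp add: frac_le)
  then show ?thesis
    unfolding osc_set_def by (blast intro: less_le_trans)
qed

text \<open>Only finitely many times enter each sum, so pointwise convergence suffices. The limit is
  not assumed to be a curve, which allows this to prove the absolute continuity of an Arzela-Ascoli
  limit.\<close>

lemma osc_set_limit:
  assumes "\<And>n. X n \<in> osc_set k j" "\<And>t. t \<in> {0..T} \<Longrightarrow> (\<lambda>n. X n t) \<longlonglongrightarrow> \<gamma> t"
    and "subintervals n a b" "(\<Sum>i<n. b i - a i) < 1 / real (Suc j)"
  shows "(\<Sum>i<n. norm (\<gamma> (b i) - \<gamma> (a i))) \<le> 1 / real (Suc k)"
proof (rule LIMSEQ_le_const2)
  show "(\<lambda>m. \<Sum>i<n. norm (X m (b i) - X m (a i))) \<longlonglongrightarrow> (\<Sum>i<n. norm (\<gamma> (b i) - \<gamma> (a i)))"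
    using assms(3) unfolding subintervals_def by (intro tendsto_intros assms(2)) auto
  show "\<exists>N. \<forall>m\<ge>N. (\<Sum>i<n. norm (X m (b i) - X m (a i))) \<le> 1 / real (Suc k)"
    using assms(1,3,4) unfolding osc_set_def by blast
qed

lemma uclosed_osc_set: "uclosed (osc_set k j)"
proof (rule uclosedI)
  show "osc_set k j \<subseteq> Curves \<Omega> T"
    by (auto simp: osc_set_def)
  fix X \<gamma> assume X: "\<And>n. X n \<in> osc_set k j" and \<gamma>: "\<gamma> \<in> Curves \<Omega> T" "(\<lambda>n. unif_dist T \<gamma> (X n)) \<longlonglongrightarrow> 0"
  have "(\<lambda>n. X n t) \<longlonglongrightarrow> \<gamma> t" for t
    using X by (intro unif_dist_tendsto \<gamma>) (simp add: osc_set_def)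
  then have "(\<Sum>i<n. norm (\<gamma> (b i) - \<gamma> (a i))) \<le> 1 / real (Suc k)"
    if "subintervals n a b" "(\<Sum>i<n. b i - a i) < 1 / real (Suc j)" for n a b
    by (rule osc_set_limit[of X, OF X _ that])
  then show "\<gamma> \<in> osc_set k j"
    using \<gamma>(1) by (simp add: osc_set_def)
qed

text \<open>For a fixed tolerance, absolute continuity supplies some threshold. Thus for each k the
  closed sets \<open>osc_set k j\<close> increase in j to the whole space.\<close>

lemma Union_osc_set: "(\<Union>j. osc_set k j) = Curves \<Omega> T"
proof
  show "Curves \<Omega> T \<subseteq> (\<Union>j. osc_set k j)"
  proof
    fix \<gamma> assume \<gamma>: "\<gamma> \<in> Curves \<Omega> T"
    have "0 < 1 / real (Suc k)" by simp
    moreover have "abs_cont_on {0..T} \<gamma>"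
      using \<gamma> by (simp add: Curves_def)
    ultimately obtain d where d: "d > 0" "\<forall>n a b. subintervals n a b \<and> (\<Sum>i<n. b i - a i) < d \<longrightarrow>
        (\<Sum>i<n. norm (\<gamma> (b i) - \<gamma> (a i))) < 1 / real (Suc k)"
      unfolding abs_cont_on_subintervals by blast
    obtain j where "1 / real (Suc j) < d"
      using d(1) nat_approx_posE by blast
    then have "\<gamma> \<in> osc_set k j"
      using \<gamma> d(2) unfolding osc_set_def by (blast intro: less_imp_le less_trans)
    then show "\<gamma> \<in> (\<Union>j. osc_set k j)" by blast
  qed
qed (auto simp: osc_set_def)

text \<open>\<open>J\<close> is a modulus of absolute continuity, one threshold for each tolerance.
  Curves sharing a modulus form a sequentially compact set, as shown next.\<close>

definition compact_curves :: "(nat \<Rightarrow> nat) \<Rightarrow> (real \<Rightarrow> 'a) set" where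
  "compact_curves J = (\<Inter>k. osc_set k (J k))"

lemma compact_curves_subset: "compact_curves J \<subseteq> Curves \<Omega> T"
  by (auto simp: compact_curves_def osc_set_def)

text \<open>Arzela-Ascoli applies: one-interval families give equicontinuity uniformly in n, and all
  values lie in a bounded set. A uniform limit of curves need not be absolutely continuous in
  general; here the common modulus passes to the limit and keeps it in the space.\<close>

lemma compact_curves_seq_compact:
  assumes X: "\<And>n. X n \<in> compact_curves J"
  obtains \<gamma> r where "\<gamma> \<in> compact_curves J" "strict_mono (r::nat \<Rightarrow> nat)"
    "(\<lambda>n. unif_dist T \<gamma> (X (r n))) \<longlonglongrightarrow> 0"
proof -
  have XC: "X n \<in> Curves \<Omega> T" for n
    using X compact_curves_subset by blast
  have Xosc: "X n \<in> osc_set k (J k)" for n k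
    using X by (auto simp: compact_curves_def)
  obtain M where M: "\<And>x. x \<in> closure \<Omega> \<Longrightarrow> norm x \<le> M"
    using bounded_closure[OF bounded_domain] unfolding bounded_iff by blast
  have equi: "\<exists>d. 0 < d \<and> (\<forall>n y. y \<in> {0..T} \<and> norm (x - y) < d \<longrightarrow> norm (X n x - X n y) < e)"
    if "x \<in> {0..T}" "0 < e" for x e
  proof -
    obtain k where k: "1 / real (Suc k) < e"
      using \<open>0 < e\<close> nat_approx_posE by blast
    have "norm (X n x - X n y) < e" if "y \<in> {0..T}" "norm (x - y) < 1 / real (Suc (J k))" for n y
    proof -
      have "subintervals 1 (\<lambda>_. min x y) (\<lambda>_. max x y)"
        using that \<open>x \<in> {0..T}\<close> by (auto simp: subintervals_def)
      moreover have "(\<Sum>i<(1::nat). max x y - min x y) < 1 / real (Suc (J k))"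
        using that by (auto simp: max_def min_def)
      ultimately have "(\<Sum>i<(1::nat). norm (X n (max x y) - X n (min x y))) \<le> 1 / real (Suc k)"
        using Xosc[of n k] unfolding osc_set_def by blast
      then show ?thesis
        using k by (auto simp: max_def min_def norm_minus_commute split: if_splits)
    qed
    then show ?thesis
      by (intro exI[of _ "1 / real (Suc (J k))"]) auto
  qed
  obtain g r where g: "continuous_on {0..T} g" "strict_mono (r::nat \<Rightarrow> nat)"
    and conv: "\<And>e. 0 < e \<Longrightarrow> \<exists>N. \<forall>n x. n \<ge> N \<and> x \<in> {0..T} \<longrightarrow> norm (X (r n) x - g x) < e"
    by (rule Arzela_Ascoli[of "{0..T}" X M]) (use M curve_mem XC equi in auto)
  \<comment> \<open>Arzela-Ascoli controls \<open>g\<close> only on [0,T], whereas a member of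
    \<open>Curves\<close> must be constant on either side.\<close>
  define \<gamma> where "\<gamma> t = g (max 0 (min T t))" for t
  have \<gamma>g: "\<gamma> t = g t" if "t \<in> {0..T}" for t
    using that by (simp add: \<gamma>_def clamp_id)
  have lim: "(\<lambda>n. X (r n) t) \<longlonglongrightarrow> \<gamma> t" if "t \<in> {0..T}" for t
    using conv that unfolding LIMSEQ_iff \<gamma>g[OF that] by blast
  have osc: "(\<Sum>i<n. norm (\<gamma> (b i) - \<gamma> (a i))) \<le> 1 / real (Suc k)"
    if "subintervals n a b" "(\<Sum>i<n. b i - a i) < 1 / real (Suc (J k))" for n a b k
    using osc_set_limit[OF Xosc lim that] .
  have "abs_cont_on {0..T} \<gamma>"
    unfolding abs_cont_on_subintervals
  proof (intro allI impI)
    fix e :: real assume "0 < e"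
    then obtain k where k: "1 / real (Suc k) < e"
      using nat_approx_posE by blast
    show "\<exists>d>0. \<forall>n a b. subintervals n a b \<and> (\<Sum>i<n. b i - a i) < d \<longrightarrow> (\<Sum>i<n. norm (\<gamma> (b i) - \<gamma> (a i))) < e"
      by (intro exI[of _ "1 / real (Suc (J k))"] conjI allI impI)
        (auto intro: le_less_trans[OF osc k])
  qed
  moreover have "\<gamma> t \<in> closure \<Omega>" if "t \<in> {0..T}" for t
    using closed_sequentially[OF closed_closure _ lim[OF that]] curve_mem[OF XC] by blast
  moreover have "\<gamma> t = \<gamma> (max 0 (min T t))" for t
    unfolding \<gamma>_def using clamp_id[OF clamp_mem[of t]] by simp
  ultimately have \<gamma>: "\<gamma> \<in> Curves \<Omega> T"
    unfolding Curves_def by blast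
  then have "\<gamma> \<in> compact_curves J"
    using osc by (auto simp: compact_curves_def osc_set_def)
  moreover have "(\<lambda>n. unif_dist T \<gamma> (X (r n))) \<longlonglongrightarrow> 0"
  proof (rule LIMSEQ_I)
    fix e :: real assume "0 < e"
    \<comment> \<open>A supremum of distances below e/2 is at most e/2, hence strictly below
      e.\<close>
    then obtain N where N: "\<And>n x. n \<ge> N \<Longrightarrow> x \<in> {0..T} \<Longrightarrow> norm (X (r n) x - g x) < e / 2"
      using conv[of "e / 2"] by auto
    have "norm (unif_dist T \<gamma> (X (r n)) - 0) < e" if "n \<ge> N" for n
    proof -
      have "unif_dist T \<gamma> (X (r n)) \<le> e / 2"
        using N[OF that] by (intro unif_dist_le less_imp_le) (simp add: \<gamma>g dist_norm norm_minus_commute)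
      then show ?thesis
        using unif_dist_nonneg[OF \<gamma> XC, of "r n"] \<open>0 < e\<close> by simp
    qed
    then show "\<exists>N. \<forall>n\<ge>N. norm (unif_dist T \<gamma> (X (r n)) - 0) < e" by blast
  qed
  ultimately show ?thesis
    using that g(2) by blast
qed

text \<open>A continuous image of a sequentially compact set: convergent starting points lift to
  curves, a subsequence of which converges within the set.\<close>

lemma closed_start_points:
  assumes "uclosed A"
  shows "closed ((\<lambda>\<gamma>. \<gamma> 0) ` (A \<inter> compact_curves J))"
  unfolding closed_sequential_limits
proof (intro allI impI, elim conjE)
  fix x l assume x: "\<forall>n. x n \<in> (\<lambda>\<gamma>. \<gamma> 0) ` (A \<inter> compact_curves J)" and l: "x \<longlonglongrightarrow> l"
  from x obtain X where X: "\<And>n. X n \<in> A" "\<And>n. X n \<in> compact_curves J" "\<And>n. x n = X n 0"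
    unfolding image_iff by (metis IntE)
  obtain \<gamma> r where \<gamma>: "\<gamma> \<in> compact_curves J" "strict_mono (r::nat \<Rightarrow> nat)"
    "(\<lambda>n. unif_dist T \<gamma> (X (r n))) \<longlonglongrightarrow> 0"
    using compact_curves_seq_compact[of X] X(2) by blast
  have \<gamma>C: "\<gamma> \<in> Curves \<Omega> T"
    using \<gamma>(1) compact_curves_subset by blast
  have "\<gamma> \<in> A"
    using uclosedD[OF assms X(1) \<gamma>C \<gamma>(3)] .
  have "(\<lambda>n. X (r n) 0) \<longlonglongrightarrow> \<gamma> 0"
    using unif_dist_tendsto[OF _ \<gamma>C \<gamma>(3)] X(1) uclosed_subset[OF assms] by blast
  moreover have "(\<lambda>n. X (r n) 0) \<longlonglongrightarrow> l"
    using LIMSEQ_subseq_LIMSEQ[OF l \<gamma>(2)] by (simp add: o_def X(3))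
  ultimately have "l = \<gamma> 0"
    using LIMSEQ_unique by blast
  then show "l \<in> (\<lambda>\<gamma>. \<gamma> 0) ` (A \<inter> compact_curves J)"
    using \<gamma>(1) \<open>\<gamma> \<in> A\<close> by blast
qed

text \<open>For each k, continuity of the measure from above gives a threshold \<open>J k\<close>
  whose exceptional set has mass below \<open>e * (1/2) ^ Suc k\<close>. These masses sum to at most
  e.\<close>

lemma compact_curves_almost_full:
  assumes \<eta>: "\<eta> \<in> Pcurves \<Omega> T" and "0 < e"
  obtains J where "measure \<eta> (Curves \<Omega> T - compact_curves J) \<le> e"
proof -
  interpret prob_space \<eta> using Pcurves_prob \<eta> .
  have sets: "Curves \<Omega> T - osc_set k j \<in> sets \<eta>" for k j
    using uclosed_sets[OF uclosed_osc_set, of k j] sets.compl_sets[of _ \<eta>]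
    by (simp add: Pcurves_sets[OF \<eta>] Pcurves_space[OF \<eta>])
  have "\<exists>j. measure \<eta> (Curves \<Omega> T - osc_set k j) < e * (1/2) ^ Suc k" for k
  proof -
    have "(\<lambda>j. measure \<eta> (Curves \<Omega> T - osc_set k j)) \<longlonglongrightarrow> measure \<eta> (\<Inter>j. Curves \<Omega> T - osc_set k j)"
    proof (rule finite_Lim_measure_decseq)
      show "decseq (\<lambda>j. Curves \<Omega> T - osc_set k j)"
        using osc_set_mono unfolding decseq_def by blast
    qed (use sets in blast)
    moreover have "(\<Inter>j. Curves \<Omega> T - osc_set k j) = {}"
      using Union_osc_set[of k] by blast
    ultimately have "(\<lambda>j. measure \<eta> (Curves \<Omega> T - osc_set k j)) \<longlonglongrightarrow> 0"
      by (simp only: measure_empty)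
    moreover have "0 < e * (1/2) ^ Suc k"
      using \<open>0 < e\<close> by simp
    ultimately have "eventually (\<lambda>j. measure \<eta> (Curves \<Omega> T - osc_set k j) < e * (1/2) ^ Suc k) sequentially"
      by (rule order_tendstoD(2))
    then show ?thesis
      unfolding eventually_sequentially by blast
  qed
  then obtain J where J: "\<And>k. measure \<eta> (Curves \<Omega> T - osc_set k (J k)) < e * (1/2) ^ Suc k"
    by metis
  have s: "(\<lambda>k. e * (1/2) ^ Suc k) sums (e * 1)"
    by (intro sums_mult power_half_series)
  have sm: "summable (\<lambda>k. measure \<eta> (Curves \<Omega> T - osc_set k (J k)))"
    by (rule summable_comparison_test'[OF sums_summable[OF s]]) (use J in \<open>simp add: less_imp_le\<close>)
  have "measure \<eta> (Curves \<Omega> T - compact_curves J) = measure \<eta> (\<Union>k. Curves \<Omega> T - osc_set k (J k))"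
    by (simp add: compact_curves_def)
  also have "\<dots> \<le> (\<Sum>k. measure \<eta> (Curves \<Omega> T - osc_set k (J k)))"
    using sets sm by (intro finite_measure_subadditive_countably) auto
  also have "\<dots> \<le> (\<Sum>k. e * (1/2) ^ Suc k)"
    using sm sums_summable[OF s] J by (intro suminf_le) (simp_all add: less_imp_le)
  also have "\<dots> = e"
    using sums_unique[OF s] by simp
  finally show ?thesis
    using that by blast
qed

text \<open>Although the curves do not form a complete space in the uniform metric, absolute continuity is
  an intersection of countable unions of conditions that survive uniform limits; this makes every
  Borel probability measure on them tight.\<close>

lemma AE_compact_curves:
  assumes \<eta>: "\<eta> \<in> Pcurves \<Omega> T"
  obtains J :: "nat \<Rightarrow> nat \<Rightarrow> nat" where "AE \<gamma> in \<eta>. \<exists>p. \<gamma> \<in> compact_curves (J p)"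
proof -
  interpret prob_space \<eta> using Pcurves_prob \<eta> .
  have "\<exists>J. measure \<eta> (Curves \<Omega> T - compact_curves J) \<le> 1 / real (Suc p)" for p
    using compact_curves_almost_full[OF \<eta>, of "1 / real (Suc p)"] by auto
  then obtain J where J: "\<And>p. measure \<eta> (Curves \<Omega> T - compact_curves (J p)) \<le> 1 / real (Suc p)"
    by metis
  have "compact_curves (J p) \<in> sets \<eta>" for p
    unfolding compact_curves_def Pcurves_sets[OF \<eta>]
    by (intro sets.countable_INT) (auto intro: uclosed_sets[OF uclosed_osc_set])
  then have sets: "Curves \<Omega> T - compact_curves (J p) \<in> sets \<eta>" for p
    using sets.compl_sets[of "compact_curves (J p)" \<eta>] by (simp add: Pcurves_space[OF \<eta>])
  \<comment> \<open>The curves missed by every compact set. The mass of \<open>N\<close> is at most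
    1/(p+1) for each p.\<close>
  define N where "N = (\<Inter>p. Curves \<Omega> T - compact_curves (J p))"
  have N: "N \<in> sets \<eta>"
    unfolding N_def using sets by (intro sets.countable_INT) auto
  have "measure \<eta> N \<le> e" if "e > 0" for e
  proof -
    obtain p where p: "1 / real (Suc p) < e"
      using \<open>0 < e\<close> nat_approx_posE by blast
    have "measure \<eta> N \<le> measure \<eta> (Curves \<Omega> T - compact_curves (J p))"
      using sets by (intro finite_measure_mono) (auto simp: N_def)
    then show ?thesis using J[of p] p by simp
  qed
  then have "measure \<eta> N \<le> 0"
    using field_le_epsilon[of "measure \<eta> N" 0] by simp
  then have "N \<in> null_sets \<eta>"
    using N by (simp add: null_sets_def emeasure_eq_measure antisym measure_le_0_iff)
  then have "AE \<gamma> in \<eta>. \<exists>p. \<gamma> \<in> compact_curves (J p)"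
    by (rule AE_I') (auto simp: N_def Pcurves_space[OF \<eta>])
  then show ?thesis using that by blast
qed

section \<open>Supports of measures on curves\<close>

text \<open>Once \<open>X n\<close> is within e/2 of the limit, the ball of radius e/2 about
  \<open>X n\<close>, which has positive mass, lies in the e-ball about the limit.\<close>

lemma uclosed_support: "uclosed (support_curves \<Omega> T \<eta>)" if \<eta>: "\<eta> \<in> Pcurves \<Omega> T"
proof (rule uclosedI)
  show "support_curves \<Omega> T \<eta> \<subseteq> Curves \<Omega> T"
    by (auto simp: support_curves_def)
  fix X \<gamma> assume X: "\<And>n. X n \<in> support_curves \<Omega> T \<eta>" and \<gamma>: "\<gamma> \<in> Curves \<Omega> T" "(\<lambda>n. unif_dist T \<gamma> (X n)) \<longlonglongrightarrow> 0"
  have "0 < emeasure \<eta> {\<gamma>'\<in>Curves \<Omega> T. unif_dist T \<gamma> \<gamma>' < e}" if "e > 0" for e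
  proof -
    have "eventually (\<lambda>n. unif_dist T \<gamma> (X n) < e / 2) sequentially"
      using order_tendstoD(2)[OF \<gamma>(2), of "e/2"] \<open>e > 0\<close> by simp
    then obtain n where n: "unif_dist T \<gamma> (X n) < e / 2"
      unfolding eventually_sequentially by blast
    have XC: "X n \<in> Curves \<Omega> T"
      using X by (auto simp: support_curves_def)
    have "0 < emeasure \<eta> {\<gamma>'\<in>Curves \<Omega> T. unif_dist T (X n) \<gamma>' < e / 2}"
      using X[of n] half_gt_zero[OF \<open>e > 0\<close>] unfolding support_curves_def by blast
    also have "\<dots> \<le> emeasure \<eta> {\<gamma>'\<in>Curves \<Omega> T. unif_dist T \<gamma> \<gamma>' < e}"
    proof (rule emeasure_mono)
      show "{\<gamma>'\<in>Curves \<Omega> T. unif_dist T (X n) \<gamma>' < e / 2} \<subseteq> {\<gamma>'\<in>Curves \<Omega> T. unif_dist T \<gamma> \<gamma>' < e}"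
        using unif_dist_triangle[OF \<gamma>(1) XC] n by fastforce
    qed (use uball_sets[OF \<gamma>(1)] Pcurves_sets[OF \<eta>] in simp)
    finally show ?thesis .
  qed
  then show "\<gamma> \<in> support_curves \<Omega> T \<eta>"
    using \<gamma>(1) by (simp add: support_curves_def)
qed

text \<open>Balls around step functions with values in a countable dense set witness separability.\<close>

definition step_ball :: "nat \<Rightarrow> nat \<Rightarrow> 'a list \<Rightarrow> (real \<Rightarrow> 'a) set" where
  "step_ball n m qs = {\<gamma>\<in>Curves \<Omega> T. \<forall>t\<in>{0..T}. dist (\<gamma> t) (qs ! nat \<lfloor>t * real n\<rfloor>) < 1 / real (Suc m)}"

text \<open>By uniform continuity the curve stays within c/2 of its value at the left node of each
  mesh interval, and a point of \<open>D\<close> approximates that value within c/2. Any two members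
  of the step ball are then at most 2c apart, which is below e since c < e/4.\<close>

lemma step_ball_approx:
  assumes \<gamma>: "\<gamma> \<in> Curves \<Omega> T" and "e > 0"
    and D: "\<And>X. open X \<Longrightarrow> X \<noteq> {} \<Longrightarrow> \<exists>d\<in>D. d \<in> X"
  obtains n m qs where "qs \<in> lists D" "\<gamma> \<in> step_ball n m qs"
    "step_ball n m qs \<subseteq> {\<gamma>'\<in>Curves \<Omega> T. unif_dist T \<gamma> \<gamma>' < e}"
proof -
  obtain m where m: "1 / real (Suc m) < e / 4"
    using \<open>e > 0\<close> nat_approx_posE[of "e/4"] by auto
  define c where "c = 1 / real (Suc m)"
  have "c > 0" by (simp add: c_def)
  have "uniformly_continuous_on {0..T} \<gamma>"
    using compact_uniformly_continuous[OF curve_continuous[OF \<gamma>] compact_Icc] .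
  then obtain d where d: "d > 0" "\<And>s t. s \<in> {0..T} \<Longrightarrow> t \<in> {0..T} \<Longrightarrow> dist t s < d \<Longrightarrow> dist (\<gamma> t) (\<gamma> s) < c / 2"
    unfolding uniformly_continuous_on_def using \<open>c > 0\<close> by (meson half_gt_zero)
  obtain n' where n': "1 / real (Suc n') < d"
    using d(1) nat_approx_posE by blast
  define n where "n = Suc n'"
  have "\<exists>q\<in>D. q \<in> ball (\<gamma> (real i / real n)) (c / 2)" for i
    using \<open>c > 0\<close> by (intro D) auto
  then obtain q where q: "\<And>i. q i \<in> D" "\<And>i. dist (\<gamma> (real i / real n)) (q i) < c / 2"
    unfolding mem_ball by metis
  \<comment> \<open>One more entry than the floor of T n, so that the index belonging to t = T is
    still valid.\<close>
  define qs where "qs = map q [0..<Suc (nat \<lfloor>T * real n\<rfloor>)]"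
  have near: "dist (\<gamma> t) (qs ! nat \<lfloor>t * real n\<rfloor>) < c" if t: "t \<in> {0..T}" for t
  proof -
    let ?i = "nat \<lfloor>t * real n\<rfloor>"
    have npos: "real n > 0" by (simp add: n_def)
    have "t * real n \<le> T * real n"
      using t by (intro mult_right_mono) auto
    then have "?i \<le> nat \<lfloor>T * real n\<rfloor>"
      by (intro nat_mono floor_mono)
    then have qi: "qs ! ?i = q ?i"
      unfolding qs_def by (subst nth_map) (auto simp del: upt_Suc)
    have i0: "0 \<le> t * real n" using t by simp
    have "real ?i \<le> t * real n" "t * real n < real ?i + 1"
      using i0 by linarith+
    then have b: "real ?i / real n \<le> t" "t < real ?i / real n + 1 / real n"
      using npos by (simp_all add: field_simps)
    have "dist t (real ?i / real n) < d"
      using b n' by (simp add: dist_real_def n_def)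
    then have "dist (\<gamma> t) (\<gamma> (real ?i / real n)) < c / 2"
      using t b by (intro d(2)) auto
    then show ?thesis
      unfolding qi using q(2)[of ?i] dist_triangle[of "\<gamma> t" "q ?i" "\<gamma> (real ?i / real n)"] by linarith
  qed
  have "qs \<in> lists D"
    using q(1) by (auto simp: qs_def)
  moreover have "\<gamma> \<in> step_ball n m qs"
    using near \<gamma> by (auto simp: step_ball_def c_def)
  moreover have "unif_dist T \<gamma> \<gamma>' < e" if "\<gamma>' \<in> step_ball n m qs" for \<gamma>'
  proof -
    have "unif_dist T \<gamma> \<gamma>' \<le> 2 * c"
    proof (rule unif_dist_le)
      fix t assume t: "t \<in> {0..T}"
      have "dist (\<gamma>' t) (qs ! nat \<lfloor>t * real n\<rfloor>) < c"
        using that t by (simp add: step_ball_def c_def)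
      then show "dist (\<gamma> t) (\<gamma>' t) \<le> 2 * c"
        using near[OF t] dist_triangle2[of "\<gamma> t" "\<gamma>' t" "qs ! nat \<lfloor>t * real n\<rfloor>"] by linarith
    qed
    then show ?thesis using m \<open>e > 0\<close> unfolding c_def by linarith
  qed
  then have "step_ball n m qs \<subseteq> {\<gamma>'\<in>Curves \<Omega> T. unif_dist T \<gamma> \<gamma>' < e}"
    by (auto simp: step_ball_def)
  ultimately show ?thesis using that by blast
qed

text \<open>A Lindelof argument: a curve outside the support has a null ball around it, and this
  ball contains a step ball around the curve from a countable family. Countably many null sets
  therefore cover the complement of the support.\<close>

lemma AE_support:
  assumes \<eta>: "\<eta> \<in> Pcurves \<Omega> T"
  shows "AE \<gamma> in \<eta>. \<gamma> \<in> support_curves \<Omega> T \<eta>"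
proof -
  obtain D :: "'a set" where D: "countable D" "\<And>X. open X \<Longrightarrow> X \<noteq> {} \<Longrightarrow> \<exists>d\<in>D. d \<in> X"
    by (rule countable_dense_setE) blast
  \<comment> \<open>Asking for a null superset avoids any question about the measurability of the
    step balls themselves.\<close>
  define I where "I = {(n, m, qs). qs \<in> lists D \<and> (\<exists>N\<in>null_sets \<eta>. step_ball n m qs \<subseteq> N)}"
  have "I \<subseteq> UNIV \<times> UNIV \<times> lists D"
    by (auto simp: I_def)
  then have "countable I"
    by (rule countable_subset) (use D(1) in \<open>auto intro!: countable_SIGMA\<close>)
  have "\<forall>i\<in>I. \<exists>N. N \<in> null_sets \<eta> \<and> (case i of (n, m, qs) \<Rightarrow> step_ball n m qs) \<subseteq> N"
    by (auto simp: I_def)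
  from bchoice[OF this] obtain N where N: "\<And>i. i \<in> I \<Longrightarrow> N i \<in> null_sets \<eta>"
    "\<And>i. i \<in> I \<Longrightarrow> (case i of (n, m, qs) \<Rightarrow> step_ball n m qs) \<subseteq> N i"
    by blast
  have "(\<Union>i\<in>I. N i) \<in> null_sets \<eta>"
    using \<open>countable I\<close> N(1) by (rule null_sets_UN')
  moreover have "{\<gamma> \<in> space \<eta>. \<gamma> \<notin> support_curves \<Omega> T \<eta>} \<subseteq> (\<Union>i\<in>I. N i)"
  proof safe
    fix \<gamma> assume "\<gamma> \<in> space \<eta>" "\<gamma> \<notin> support_curves \<Omega> T \<eta>"
    then obtain e where \<gamma>: "\<gamma> \<in> Curves \<Omega> T" and "e > 0"
      and "emeasure \<eta> {\<gamma>'\<in>Curves \<Omega> T. unif_dist T \<gamma> \<gamma>' < e} = 0"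
      by (auto simp: support_curves_def Pcurves_space[OF \<eta>])
    then have null: "{\<gamma>'\<in>Curves \<Omega> T. unif_dist T \<gamma> \<gamma>' < e} \<in> null_sets \<eta>"
      using uball_sets[OF \<gamma>] by (auto simp: null_sets_def Pcurves_sets[OF \<eta>])
    obtain n m qs where "qs \<in> lists D" "\<gamma> \<in> step_ball n m qs"
      "step_ball n m qs \<subseteq> {\<gamma>'\<in>Curves \<Omega> T. unif_dist T \<gamma> \<gamma>' < e}"
      by (rule step_ball_approx[OF \<gamma> \<open>e > 0\<close> D(2)])
    then have "(n, m, qs) \<in> I" "\<gamma> \<in> N (n, m, qs)"
      using null N(2)[of "(n, m, qs)"] by (auto simp: I_def)
    then show "\<gamma> \<in> (\<Union>i\<in>I. N i)" by blast
  qed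
  ultimately show ?thesis
    by (rule AE_I')
qed

section \<open>Measurable dependence on time and on starting points\<close>

text \<open>Sampling at the time rounded down to a multiple of 1/(n+1) involves only countably many
  evaluations, hence is measurable. Continuity of the curves makes the samples converge. This is
  what Fubini requires below.\<close>

lemma eval_jointly_measurable:
  assumes \<eta>: "\<eta> \<in> Pcurves \<Omega> T"
  shows "(\<lambda>p. fst p (snd p)) \<in> borel_measurable (\<eta> \<Otimes>\<^sub>M (lborel :: real measure))"
proof (rule borel_measurable_LIMSEQ_metric)
  have ev: "(\<lambda>\<gamma>. \<gamma> t) \<in> borel_measurable \<eta>" for t
    using eval_measurable_Pcurves(2)[OF \<eta>] .
  fix n :: nat
  show "(\<lambda>p. fst p (real_of_int \<lfloor>snd p * real (Suc n)\<rfloor> / real (Suc n))) \<in> borel_measurable (\<eta> \<Otimes>\<^sub>M lborel)"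
  proof (rule measurable_compose_countable[where f = "\<lambda>(i::int) p. fst p (real_of_int i / real (Suc n))"])
    show "(\<lambda>p. fst p (real_of_int i / real (Suc n))) \<in> borel_measurable (\<eta> \<Otimes>\<^sub>M lborel)" for i
      by (rule measurable_compose[OF measurable_fst ev])
    show "(\<lambda>p. \<lfloor>snd p * real (Suc n)\<rfloor>) \<in> \<eta> \<Otimes>\<^sub>M lborel \<rightarrow>\<^sub>M count_space UNIV"
      by measurable
  qed
next
  fix p assume "p \<in> space (\<eta> \<Otimes>\<^sub>M (lborel :: real measure))"
  then have \<gamma>: "fst p \<in> Curves \<Omega> T"
    by (auto simp: space_pair_measure Pcurves_space[OF \<eta>])
  have "(\<lambda>n. real_of_int \<lfloor>snd p * real (Suc n)\<rfloor> / real (Suc n)) \<longlonglongrightarrow> snd p"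
  proof (rule LIMSEQ_I)
    fix e :: real assume "0 < e"
    then obtain N where N: "1 / real (Suc N) < e"
      using nat_approx_posE by blast
    have "norm (real_of_int \<lfloor>snd p * real (Suc n)\<rfloor> / real (Suc n) - snd p) < e" if "n \<ge> N" for n
    proof -
      have "real_of_int \<lfloor>snd p * real (Suc n)\<rfloor> \<le> snd p * real (Suc n)"
        "snd p * real (Suc n) < real_of_int \<lfloor>snd p * real (Suc n)\<rfloor> + 1"
        by linarith+
      then have "real_of_int \<lfloor>snd p * real (Suc n)\<rfloor> / real (Suc n) \<le> snd p"
        "snd p < real_of_int \<lfloor>snd p * real (Suc n)\<rfloor> / real (Suc n) + 1 / real (Suc n)"
        by (simp_all add: field_simps del: of_nat_Suc)
      moreover have "1 / real (Suc n) \<le> 1 / real (Suc N)"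
        using that by (simp add: frac_le)
      ultimately show ?thesis
        using N by (simp del: of_nat_Suc)
    qed
    then show "\<exists>N. \<forall>n\<ge>N. norm (real_of_int \<lfloor>snd p * real (Suc n)\<rfloor> / real (Suc n) - snd p) < e"
      by blast
  qed
  then show "(\<lambda>n. fst p (real_of_int \<lfloor>snd p * real (Suc n)\<rfloor> / real (Suc n))) \<longlonglongrightarrow> fst p (snd p)"
    by (rule continuous_on_tendsto_compose[OF curve_continuous[OF \<gamma>, of UNIV]]) auto
qed

text \<open>Compactness turns suprema over all curves with a given starting point into Borel functions of
  that point. This replaces the measurability of the value function in the comparison.\<close>

lemma integral_le_by_start_points:
  fixes D :: "(real \<Rightarrow> 'a) \<Rightarrow> real"
  assumes \<eta>1: "\<eta>1 \<in> Pcurves \<Omega> T" and \<eta>2: "\<eta>2 \<in> Pcurves \<Omega> T"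
    and start: "mflow \<Omega> \<eta>1 0 = mflow \<Omega> \<eta>2 0"
    and bound: "\<And>\<gamma>. \<gamma> \<in> Curves \<Omega> T \<Longrightarrow> \<bar>D \<gamma>\<bar> \<le> M"
    and cont: "\<And>X \<gamma>. (\<And>n. X n \<in> Curves \<Omega> T) \<Longrightarrow> \<gamma> \<in> Curves \<Omega> T \<Longrightarrow>
      (\<lambda>n. unif_dist T \<gamma> (X n)) \<longlonglongrightarrow> 0 \<Longrightarrow> (\<lambda>n. D (X n)) \<longlonglongrightarrow> D \<gamma>"
    and le: "\<And>\<gamma>1 \<gamma>2. \<gamma>1 \<in> support_curves \<Omega> T \<eta>1 \<Longrightarrow> \<gamma>2 \<in> support_curves \<Omega> T \<eta>2 \<Longrightarrow>
      \<gamma>1 0 = \<gamma>2 0 \<Longrightarrow> D \<gamma>1 \<le> D \<gamma>2"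
  shows "(\<integral>\<gamma>. D \<gamma> \<partial>\<eta>1) \<le> (\<integral>\<gamma>. D \<gamma> \<partial>\<eta>2)"
proof -
  define level where "level a = {\<gamma>\<in>Curves \<Omega> T. a \<le> D \<gamma>}" for a
  have level: "uclosed (level a)" for a
  proof (rule uclosedI)
    fix X \<gamma> assume X: "\<And>n. X n \<in> level a" and \<gamma>: "\<gamma> \<in> Curves \<Omega> T" "(\<lambda>n. unif_dist T \<gamma> (X n)) \<longlonglongrightarrow> 0"
    have "(\<lambda>n. D (X n)) \<longlonglongrightarrow> D \<gamma>"
      using X \<gamma> by (intro cont) (auto simp: level_def)
    then have "a \<le> D \<gamma>"
      by (rule LIMSEQ_le_const) (use X in \<open>auto simp: level_def\<close>)
    then show "\<gamma> \<in> level a" using \<gamma>(1) by (simp add: level_def)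
  qed (auto simp: level_def)
  have D_meas: "D \<in> borel_measurable \<eta>" if "\<eta> \<in> Pcurves \<Omega> T" for \<eta>
    unfolding borel_measurable_iff_ge
    using uclosed_sets[OF level] by (auto simp: level_def Pcurves_space[OF that] Pcurves_sets[OF that])
  have D_int: "integrable \<eta> D" if \<eta>: "\<eta> \<in> Pcurves \<Omega> T" for \<eta>
  proof -
    interpret prob_space \<eta> using Pcurves_prob \<eta> .
    show ?thesis
      using bound D_meas[OF \<eta>] by (intro integrable_const_bound[of _ M]) (auto simp: Pcurves_space[OF \<eta>])
  qed
  obtain J :: "nat \<Rightarrow> nat \<Rightarrow> nat" where J: "AE \<gamma> in \<eta>1. \<exists>p. \<gamma> \<in> compact_curves (J p)"
    by (rule AE_compact_curves[OF \<eta>1])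
  \<comment> \<open>The part of the support of \<eta>1 covered by the compact sets; it carries
    \<eta>1 almost surely.\<close>
  define R where "R = (\<Union>p. support_curves \<Omega> T \<eta>1 \<inter> compact_curves (J p))"
  have R: "R \<subseteq> support_curves \<Omega> T \<eta>1" "R \<subseteq> Curves \<Omega> T"
    by (auto simp: R_def support_curves_def)
  \<comment> \<open>Inserting \<open>-M\<close> keeps the supremum defined at points where no curve
    of \<open>R\<close> starts. It is harmless because \<open>D\<close> is at least
    \<open>-M\<close> on all curves.\<close>
  define V where "V x = insert (-M) (D ` {\<gamma>\<in>R. \<gamma> 0 = x})" for x
  define f where "f x = Sup (V x)" for x
  \<comment> \<open>No sign is assumed for \<open>M\<close>, so the inserted value \<open>-M\<close>
    is kept as a separate case.\<close>
  have V_le: "v \<le> M \<or> v = -M" if "v \<in> V x" for v x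
    using that bound R(2) by (auto simp: V_def abs_le_iff)
  have bdd: "bdd_above (V x)" for x
    by (rule bdd_aboveI[of _ "max M (-M)"]) (use V_le in force)
  have V_ne: "V x \<noteq> {}" for x
    by (simp add: V_def)
  have "{x. a < f x} \<in> sets borel" for a
  proof -
    \<comment> \<open>The supremum exceeds a exactly when some member does. Replacing the strict
      inequality by the levels a + 1/(n+1) writes the set as a countable union of starting points of
      closed pieces of compact sets, each of which is closed.\<close>
    let ?C = "\<lambda>p n. (\<lambda>\<gamma>. \<gamma> 0) ` ((support_curves \<Omega> T \<eta>1 \<inter> level (a + 1 / real (Suc n))) \<inter> compact_curves (J p))"
    have "{x. a < f x} = {x. a < -M} \<union> (\<Union>p n. ?C p n)"
    proof (intro set_eqI iffI)
      fix x assume "x \<in> {x. a < f x}"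
      then obtain v where v: "v \<in> V x" "a < v"
        using less_cSup_iff[OF V_ne bdd] by (auto simp: f_def)
      show "x \<in> {x. a < -M} \<union> (\<Union>p n. ?C p n)"
      proof (cases "v = -M")
        case False
        then obtain \<gamma> p where \<gamma>: "v = D \<gamma>" "\<gamma> \<in> support_curves \<Omega> T \<eta>1" "\<gamma> \<in> compact_curves (J p)" "\<gamma> 0 = x"
          using v(1) by (auto simp: V_def R_def)
        obtain n where "1 / real (Suc n) < v - a"
          using v(2) nat_approx_posE[of "v - a"] by auto
        then have "\<gamma> \<in> level (a + 1 / real (Suc n))"
          using \<gamma>(1,3) compact_curves_subset by (auto simp: level_def)
        then have "x \<in> ?C p n"
          using \<gamma> by blast
        then show ?thesis by blast
      qed (use v in auto)
    next
      fix x assume "x \<in> {x. a < -M} \<union> (\<Union>p n. ?C p n)"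
      then have "\<exists>v\<in>V x. a < v"
      proof
        assume "x \<in> (\<Union>p n. ?C p n)"
        then obtain p n \<gamma> where \<gamma>: "\<gamma> \<in> support_curves \<Omega> T \<eta>1" "\<gamma> \<in> level (a + 1 / real (Suc n))"
          "\<gamma> \<in> compact_curves (J p)" "\<gamma> 0 = x"
          by blast
        have "a < a + 1 / real (Suc n)" by simp
        also have "\<dots> \<le> D \<gamma>" using \<gamma>(2) by (simp only: level_def mem_Collect_eq)
        finally show ?thesis using \<gamma> by (auto simp: V_def R_def)
      qed (auto simp: V_def)
      then show "x \<in> {x. a < f x}"
        using less_cSup_iff[OF V_ne bdd] by (simp add: f_def)
    qed
    moreover have "?C p n \<in> sets borel" for p n
      by (intro borel_closed closed_start_points uclosed_Int uclosed_support \<eta>1 level)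
    ultimately show ?thesis
      by auto
  qed
  then have f_borel: "f \<in> borel_measurable borel"
    unfolding borel_measurable_iff_greater by simp
  then have f_meas: "f \<in> borel_measurable (restrict_space borel (closure \<Omega>))"
    by (rule measurable_restrict_space1)
  have f_bound: "\<bar>f x\<bar> \<le> \<bar>M\<bar>" for x
  proof -
    have "-M \<le> f x"
      unfolding f_def by (rule cSup_upper[OF _ bdd]) (simp add: V_def)
    moreover have "f x \<le> \<bar>M\<bar>"
      unfolding f_def by (rule cSup_least[OF V_ne]) (use V_le in force)
    ultimately show ?thesis by linarith
  qed
  have f_int: "integrable \<eta> (\<lambda>\<gamma>. f (\<gamma> 0))" if \<eta>: "\<eta> \<in> Pcurves \<Omega> T" for \<eta>
  proof -
    interpret prob_space \<eta> using Pcurves_prob \<eta> .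
    show ?thesis
      using f_bound measurable_compose[OF eval_measurable_Pcurves(1)[OF \<eta>] f_meas]
      by (intro integrable_const_bound[of _ "\<bar>M\<bar>"]) auto
  qed
  have f_mflow: "(\<integral>\<gamma>. f (\<gamma> 0) \<partial>\<eta>) = (\<integral>x. f x \<partial>mflow \<Omega> \<eta> 0)" if "\<eta> \<in> Pcurves \<Omega> T" for \<eta>
    unfolding mflow_def using integral_distr[OF eval_measurable_Pcurves(1)[OF that] f_meas] by simp
  have "(\<integral>\<gamma>. D \<gamma> \<partial>\<eta>1) \<le> (\<integral>\<gamma>. f (\<gamma> 0) \<partial>\<eta>1)"
  proof (rule integral_mono_AE[OF D_int[OF \<eta>1] f_int[OF \<eta>1]])
    show "AE \<gamma> in \<eta>1. D \<gamma> \<le> f (\<gamma> 0)"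
      using J AE_support[OF \<eta>1]
    proof eventually_elim
      case (elim \<gamma>)
      then have "D \<gamma> \<in> V (\<gamma> 0)"
        by (auto simp: V_def R_def)
      then show ?case
        unfolding f_def by (rule cSup_upper[OF _ bdd])
    qed
  qed
  also have "\<dots> = (\<integral>\<gamma>. f (\<gamma> 0) \<partial>\<eta>2)"
    using f_mflow[OF \<eta>1] f_mflow[OF \<eta>2] start by simp
  also have "\<dots> \<le> (\<integral>\<gamma>. D \<gamma> \<partial>\<eta>2)"
  proof (rule integral_mono_AE[OF f_int[OF \<eta>2] D_int[OF \<eta>2]])
    show "AE \<gamma> in \<eta>2. f (\<gamma> 0) \<le> D \<gamma>"
      using AE_support[OF \<eta>2]
    proof eventually_elim
      case (elim \<gamma>)
      then have "\<gamma> \<in> Curves \<Omega> T"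
        by (simp add: support_curves_def)
      show ?case
        unfolding f_def
      \<comment> \<open>The inserted value lies below \<open>D\<close> by the bound; every other
        value comes from a curve in the support of \<eta>1 with the same starting point, where
        \<open>le\<close> applies.\<close>
      proof (rule cSup_least[OF V_ne])
        fix v assume "v \<in> V (\<gamma> 0)"
        then show "v \<le> D \<gamma>"
          using bound[OF \<open>\<gamma> \<in> Curves \<Omega> T\<close>] le[OF _ elim] R(1) by (auto simp: V_def abs_le_iff)
      qed
    qed
  qed
  finally show ?thesis .
qed

section \<open>Cost terms without the Lagrangian\<close>

text \<open>With \<open>h\<close> and \<open>g\<close> the couplings along one flow, this is the
  cost without its Lagrangian term; with their differences along two flows, it is the functional D
  of the introduction.\<close>

definition path_functional :: "(real \<Rightarrow> 'a \<Rightarrow> real) \<Rightarrow> ('a \<Rightarrow> real) \<Rightarrow> (real \<Rightarrow> 'a) \<Rightarrow> real" where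
  "path_functional h g \<gamma> = (LINT t:{0..T}|lborel. h t (\<gamma> t)) + g (\<gamma> T)"

context
  fixes h :: "real \<Rightarrow> 'a \<Rightarrow> real"
  assumes h: "continuous_on (UNIV \<times> closure \<Omega>) (\<lambda>(t,x). h t x)"
begin

lemma running_bound: obtains B where "\<And>t x. t \<in> {0..T} \<Longrightarrow> x \<in> closure \<Omega> \<Longrightarrow> \<bar>h t x\<bar> \<le> B"
proof -
  have "continuous_on ({0..T} \<times> closure \<Omega>) (\<lambda>(t,x). h t x)"
    using h by (rule continuous_on_subset) auto
  then have "bounded ((\<lambda>(t,x). h t x) ` ({0..T} \<times> closure \<Omega>))"
    by (intro compact_imp_bounded compact_continuous_image compact_Times compact_closure_domain) auto
  then obtain B where "\<forall>y\<in>(\<lambda>(t,x). h t x) ` ({0..T} \<times> closure \<Omega>). norm y \<le> B"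
    unfolding bounded_iff by blast
  then show ?thesis
    by (intro that[of B]) force
qed

lemma running_continuous:
  assumes "\<gamma> \<in> Curves \<Omega> T"
  shows "continuous_on S (\<lambda>t. h t (\<gamma> t))"
proof -
  have "continuous_on S (\<lambda>t. (\<lambda>(t,x). h t x) (t, \<gamma> t))"
    by (rule continuous_on_compose2[OF h])
      (use curve_mem[OF assms] in \<open>auto intro!: continuous_intros curve_continuous[OF assms]\<close>)
  then show ?thesis by simp
qed

lemma running_integrable: "\<gamma> \<in> Curves \<Omega> T \<Longrightarrow> set_integrable lborel {a..b} (\<lambda>t. h t (\<gamma> t))"
  by (rule borel_integrable_atLeastAtMost'[OF running_continuous])

lemma running_continuous_space: "continuous_on (closure \<Omega>) (h t)"
proof -
  have "continuous_on (closure \<Omega>) (\<lambda>x. (\<lambda>(t,x). h t x) (t, x))"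
    by (rule continuous_on_compose2[OF h]) (auto intro!: continuous_intros)
  then show ?thesis by simp
qed

text \<open>Continuity in time is what later turns a vanishing time integral of the gap into
  vanishing at every time.\<close>

lemma mean_running_continuous:
  assumes \<eta>: "\<eta> \<in> Pcurves \<Omega> T"
  shows "continuous_on {0..T} (\<lambda>t. \<integral>\<gamma>. h t (\<gamma> t) \<partial>\<eta>)"
proof -
  obtain B where B: "\<And>t x. t \<in> {0..T} \<Longrightarrow> x \<in> closure \<Omega> \<Longrightarrow> \<bar>h t x\<bar> \<le> B"
    by (rule running_bound) blast
  show ?thesis
    by (rule continuous_on_integral_param[OF Pcurves_prob[OF \<eta>], where B = B])
      (use B curve_mem continuous_eval_measurable[OF \<eta> running_continuous_space] running_continuous
        in \<open>auto simp: Pcurves_space[OF \<eta>]\<close>)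
qed

context
  fixes g :: "'a \<Rightarrow> real"
  assumes g: "continuous_on (closure \<Omega>) g"
begin

lemma path_functional_bound:
  obtains M where "\<And>\<gamma>. \<gamma> \<in> Curves \<Omega> T \<Longrightarrow> \<bar>path_functional h g \<gamma>\<bar> \<le> M"
proof -
  obtain B where B: "\<And>t x. t \<in> {0..T} \<Longrightarrow> x \<in> closure \<Omega> \<Longrightarrow> \<bar>h t x\<bar> \<le> B"
    by (rule running_bound) blast
  have "bounded (g ` closure \<Omega>)"
    using compact_continuous_image[OF g compact_closure_domain] compact_imp_bounded by blast
  then obtain B' where B': "\<And>x. x \<in> closure \<Omega> \<Longrightarrow> \<bar>g x\<bar> \<le> B'"
    unfolding bounded_iff by auto
  have "\<bar>path_functional h g \<gamma>\<bar> \<le> T * B + B'" if \<gamma>: "\<gamma> \<in> Curves \<Omega> T" for \<gamma>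
  proof -
    have "norm (LINT t:{0..T}|lborel. h t (\<gamma> t)) \<le> (LINT t:{0..T}|lborel. norm (h t (\<gamma> t)))"
      using running_integrable[OF \<gamma>] by (intro set_integral_norm_bound) auto
    also have "\<dots> \<le> (LINT t:{0..T}|lborel. B)"
      using running_integrable[OF \<gamma>] B curve_mem[OF \<gamma>]
      by (intro set_integral_mono set_integrable_norm borel_integrable_atLeastAtMost'[OF continuous_on_const]) auto
    also have "\<dots> = T * B"
      using T_pos by (simp add: set_lebesgue_integral_def)
    finally show ?thesis
      using B'[OF curve_mem[OF \<gamma>, of T]] unfolding path_functional_def by simp
  qed
  then show ?thesis using that by blast
qed

text \<open>Uniform convergence is pointwise convergence in particular, and the running term is
  bounded on [0,T], so dominated convergence applies.\<close>

lemma path_functional_continuous: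
  assumes X: "\<And>n. X n \<in> Curves \<Omega> T" and \<gamma>: "\<gamma> \<in> Curves \<Omega> T" "(\<lambda>n. unif_dist T \<gamma> (X n)) \<longlonglongrightarrow> 0"
  shows "(\<lambda>n. path_functional h g (X n)) \<longlonglongrightarrow> path_functional h g \<gamma>"
proof -
  obtain B where B: "\<And>t x. t \<in> {0..T} \<Longrightarrow> x \<in> closure \<Omega> \<Longrightarrow> \<bar>h t x\<bar> \<le> B"
    by (rule running_bound) blast
  have conv: "(\<lambda>n. X n t) \<longlonglongrightarrow> \<gamma> t" for t
    by (rule unif_dist_tendsto[OF X \<gamma>])
  have "(\<lambda>n. LINT t:{0..T}|lborel. h t (X n t)) \<longlonglongrightarrow> (LINT t:{0..T}|lborel. h t (\<gamma> t))"
    unfolding set_lebesgue_integral_def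
  proof (rule integral_dominated_convergence[where w = "\<lambda>t. indicator {0..T} t * B"])
    show "(\<lambda>t. indicator {0..T} t *\<^sub>R h t (\<gamma> t)) \<in> borel_measurable lborel"
      "(\<lambda>t. indicator {0..T} t *\<^sub>R h t (X n t)) \<in> borel_measurable lborel" for n
      using running_integrable[OF \<gamma>(1)] running_integrable[OF X, of _ _ n]
      by (auto simp: set_integrable_def)
    show "AE t in lborel. (\<lambda>n. indicator {0..T} t *\<^sub>R h t (X n t)) \<longlonglongrightarrow> indicator {0..T} t *\<^sub>R h t (\<gamma> t)"
    proof (rule AE_I2, rule tendsto_scaleR[OF tendsto_const])
      fix t
      show "(\<lambda>n. h t (X n t)) \<longlonglongrightarrow> h t (\<gamma> t)"
        by (rule continuous_on_tendsto_compose[OF running_continuous_space conv])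
          (use curve_mem X \<gamma>(1) in auto)
    qed
    show "AE t in lborel. norm (indicator {0..T} t *\<^sub>R h t (X n t)) \<le> indicator {0..T} t * B" for n
      using B curve_mem[OF X] by (auto simp: indicator_def)
    show "integrable lborel (\<lambda>t. indicator {0..T} t * B)"
      using borel_integrable_atLeastAtMost'[of 0 T "\<lambda>_. B"] by (simp add: set_integrable_def)
  qed
  moreover have "(\<lambda>n. g (X n T)) \<longlonglongrightarrow> g (\<gamma> T)"
    by (rule continuous_on_tendsto_compose[OF g conv]) (use curve_mem X \<gamma>(1) in auto)
  ultimately show ?thesis
    unfolding path_functional_def by (rule tendsto_add)
qed

text \<open>Fubini for a bounded integrand on the product of a probability space with [0,T].\<close>

lemma path_functional_integral:
  assumes \<eta>: "\<eta> \<in> Pcurves \<Omega> T"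
  shows "(\<integral>\<gamma>. path_functional h g \<gamma> \<partial>\<eta>) =
    (LINT t:{0..T}|lborel. \<integral>\<gamma>. h t (\<gamma> t) \<partial>\<eta>) + (\<integral>\<gamma>. g (\<gamma> T) \<partial>\<eta>)"
proof -
  interpret prob_space \<eta> using Pcurves_prob \<eta> .
  interpret pair_sigma_finite \<eta> "lborel :: real measure" ..
  obtain B where B: "\<And>t x. t \<in> {0..T} \<Longrightarrow> x \<in> closure \<Omega> \<Longrightarrow> \<bar>h t x\<bar> \<le> B"
    by (rule running_bound) blast
  let ?f = "\<lambda>\<gamma> t. indicator {0..T} t *\<^sub>R h t (\<gamma> t)"
  \<comment> \<open>Continuity of \<open>h\<close> is known only over the closed domain. Cutting off
    there gives a Borel function on the whole product, and the cutoff is invisible along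
    curves.\<close>
  let ?h = "\<lambda>p. indicator (UNIV \<times> closure \<Omega>) p *\<^sub>R (case p of (t, x) \<Rightarrow> h t x)"
  have "?h \<in> borel_measurable borel"
    by (intro borel_measurable_continuous_on_indicator h borel_closed closed_Times) auto
  moreover have "(\<lambda>p. (snd p, fst p (snd p))) \<in> borel_measurable (\<eta> \<Otimes>\<^sub>M (lborel :: real measure))"
    by (intro borel_measurable_Pair eval_jointly_measurable[OF \<eta>]) simp
  ultimately have "(\<lambda>p. ?h (snd p, fst p (snd p))) \<in> borel_measurable (\<eta> \<Otimes>\<^sub>M (lborel :: real measure))"
    by (rule measurable_compose_rev)
  then have "(\<lambda>p. indicator {0..T} (snd p) *\<^sub>R ?h (snd p, fst p (snd p))) \<in> borel_measurable (\<eta> \<Otimes>\<^sub>M (lborel :: real measure))"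
    by (rule borel_measurable_scaleR[rotated]) simp
  then have meas: "(\<lambda>(\<gamma>, t). ?f \<gamma> t) \<in> borel_measurable (\<eta> \<Otimes>\<^sub>M (lborel :: real measure))"
    by (rule measurable_cong[THEN iffD1, rotated])
      (auto simp: space_pair_measure Pcurves_space[OF \<eta>] curve_mem)
  have int: "integrable (\<eta> \<Otimes>\<^sub>M lborel) (\<lambda>(\<gamma>, t). ?f \<gamma> t)"
  proof (rule integrableI_bounded_set[where A = "space \<eta> \<times> {0..T}" and B = B])
    show "emeasure (\<eta> \<Otimes>\<^sub>M lborel) (space \<eta> \<times> {0..T}) < \<infinity>"
      using T_pos by (subst lborel.emeasure_pair_measure_Times) (auto simp: emeasure_space_1)
    show "AE p in \<eta> \<Otimes>\<^sub>M lborel. p \<in> space \<eta> \<times> {0..T} \<longrightarrow> norm (case p of (\<gamma>, t) \<Rightarrow> ?f \<gamma> t) \<le> B"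
      using B curve_mem by (intro AE_I2) (auto simp: Pcurves_space[OF \<eta>])
    show "AE p in \<eta> \<Otimes>\<^sub>M lborel. p \<notin> space \<eta> \<times> {0..T} \<longrightarrow> (case p of (\<gamma>, t) \<Rightarrow> ?f \<gamma> t) = 0"
      by (intro AE_I2) (auto simp: space_pair_measure indicator_def)
  qed (use meas in auto)
  have "(\<integral>\<gamma>. path_functional h g \<gamma> \<partial>\<eta>) = (\<integral>\<gamma>. (\<integral>t. ?f \<gamma> t \<partial>lborel) \<partial>\<eta>) + (\<integral>\<gamma>. g (\<gamma> T) \<partial>\<eta>)"
    unfolding path_functional_def set_lebesgue_integral_def
    by (rule Bochner_Integration.integral_add[OF integrable_fst[OF int] continuous_eval_integrable[OF \<eta> g]])
  also have "(\<integral>\<gamma>. (\<integral>t. ?f \<gamma> t \<partial>lborel) \<partial>\<eta>) = (\<integral>t. (\<integral>\<gamma>. ?f \<gamma> t \<partial>\<eta>) \<partial>lborel)"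
    using Fubini_integral[OF int] by simp
  also have "\<dots> = (LINT t:{0..T}|lborel. \<integral>\<gamma>. h t (\<gamma> t) \<partial>\<eta>)"
    by (simp add: set_lebesgue_integral_def)
  finally show ?thesis .
qed

end

end

lemma path_functional_diff:
  assumes "continuous_on (UNIV \<times> closure \<Omega>) (\<lambda>(t,x). h1 t x)"
    and "continuous_on (UNIV \<times> closure \<Omega>) (\<lambda>(t,x). h2 t x)" and \<gamma>: "\<gamma> \<in> Curves \<Omega> T"
  shows "path_functional (\<lambda>t x. h1 t x - h2 t x) (\<lambda>x. g1 x - g2 x) \<gamma> =
    path_functional h1 g1 \<gamma> - path_functional h2 g2 \<gamma>"
  using running_integrable[OF assms(1) \<gamma>] running_integrable[OF assms(2) \<gamma>]
  by (simp add: path_functional_def set_integral_diff(2))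

section \<open>Cost functionals and optimal curves\<close>

text \<open>The running coupling is continuous along a curve and hence integrable. Finiteness of the
  cost thus depends on the Lagrangian alone and is the same for all measures on curves.\<close>

lemma Jcost_eq_path_functional:
  assumes \<eta>: "\<eta> \<in> Pcurves \<Omega> T" and F: "cont_on_OmegaP \<Omega> F" and \<gamma>: "\<gamma> \<in> Curves \<Omega> T"
  shows "Jcost \<Omega> L F G T \<eta> \<gamma> =
    (if set_integrable lborel {0..T} (\<lambda>s. L (\<gamma> s) (vector_derivative \<gamma> (at s)))
     then ereal ((LINT s:{0..T}|lborel. L (\<gamma> s) (vector_derivative \<gamma> (at s))) +
       path_functional (\<lambda>t x. F x (mflow \<Omega> \<eta> t)) (\<lambda>x. G x (mflow \<Omega> \<eta> T)) \<gamma>)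
     else \<infinity>)"
proof -
  have F': "set_integrable lborel {0..T} (\<lambda>s. F (\<gamma> s) (mflow \<Omega> \<eta> s))"
    by (rule running_integrable[OF continuous_along_mflow[OF \<eta> F] \<gamma>])
  show ?thesis
    unfolding Jcost_def cost_from_def eint_def set_integrable_add_iff[OF F'] path_functional_def
    by (simp add: set_integral_add(2)[OF _ F'] add.assoc)
qed

text \<open>A curve at rest has constant Lagrangian. It is the competitor that makes the cost of
  every optimal curve finite.\<close>

lemma Jcost_const_finite:
  assumes "\<eta> \<in> Pcurves \<Omega> T" "cont_on_OmegaP \<Omega> F" "x \<in> closure \<Omega>"
  shows "Jcost \<Omega> L F G T \<eta> (\<lambda>_. x) < \<infinity>"
  unfolding Jcost_eq_path_functional[OF assms(1,2) const_curve[OF assms(3)]]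
  using borel_integrable_atLeastAtMost'[of 0 T "\<lambda>_. L x 0"] by simp

text \<open>The running cost L enters both functionals in the same way, so it drops out when the optimality
  of each curve is tested with the other one.\<close>

lemma optimal_exchange:
  assumes \<eta>1: "\<eta>1 \<in> Pcurves \<Omega> T" and \<eta>2: "\<eta>2 \<in> Pcurves \<Omega> T" and F: "cont_on_OmegaP \<Omega> F"
    and opt: "\<gamma>1 \<in> optimal_curves \<Omega> L F G T \<eta>1 x" "\<gamma>2 \<in> optimal_curves \<Omega> L F G T \<eta>2 x"
  shows "path_functional (\<lambda>t x. F x (mflow \<Omega> \<eta>1 t) - F x (mflow \<Omega> \<eta>2 t))
      (\<lambda>x. G x (mflow \<Omega> \<eta>1 T) - G x (mflow \<Omega> \<eta>2 T)) \<gamma>1 \<le>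
    path_functional (\<lambda>t x. F x (mflow \<Omega> \<eta>1 t) - F x (mflow \<Omega> \<eta>2 t))
      (\<lambda>x. G x (mflow \<Omega> \<eta>1 T) - G x (mflow \<Omega> \<eta>2 T)) \<gamma>2"
proof -
  have C: "\<gamma>1 \<in> Curves \<Omega> T" "\<gamma>2 \<in> Curves \<Omega> T" "\<gamma>1 0 = x" "\<gamma>2 0 = x"
    using opt by (auto simp: optimal_curves_def)
  have x: "x \<in> closure \<Omega>"
    using C curve_mem by blast
  have le: "Jcost \<Omega> L F G T \<eta>1 \<gamma>1 \<le> Jcost \<Omega> L F G T \<eta>1 \<gamma>2"
    "Jcost \<Omega> L F G T \<eta>2 \<gamma>2 \<le> Jcost \<Omega> L F G T \<eta>2 \<gamma>1"
    using opt C by (auto simp: optimal_curves_def)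
  \<comment> \<open>Finiteness has to come first: only real Lagrangian integrals can be cancelled
    when the two inequalities in \<open>le\<close> are added.\<close>
  have "Jcost \<Omega> L F G T \<eta>1 \<gamma>1 \<le> Jcost \<Omega> L F G T \<eta>1 (\<lambda>_. x)"
    "Jcost \<Omega> L F G T \<eta>2 \<gamma>2 \<le> Jcost \<Omega> L F G T \<eta>2 (\<lambda>_. x)"
    using opt const_curve[OF x] by (auto simp: optimal_curves_def)
  then have fin: "Jcost \<Omega> L F G T \<eta>1 \<gamma>1 < \<infinity>" "Jcost \<Omega> L F G T \<eta>2 \<gamma>2 < \<infinity>"
    using Jcost_const_finite[OF \<eta>1 F x] Jcost_const_finite[OF \<eta>2 F x] by (meson le_less_trans)+
  have int: "set_integrable lborel {0..T} (\<lambda>s. L (\<gamma>1 s) (vector_derivative \<gamma>1 (at s)))"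
    "set_integrable lborel {0..T} (\<lambda>s. L (\<gamma>2 s) (vector_derivative \<gamma>2 (at s)))"
    using fin unfolding Jcost_eq_path_functional[OF \<eta>1 F C(1)] Jcost_eq_path_functional[OF \<eta>2 F C(2)]
    by (auto split: if_splits)
  note diff = path_functional_diff[OF continuous_along_mflow[OF \<eta>1 F] continuous_along_mflow[OF \<eta>2 F]]
  show ?thesis
    using le int
    unfolding diff[OF C(1)] diff[OF C(2)]
      Jcost_eq_path_functional[OF \<eta>1 F C(1)] Jcost_eq_path_functional[OF \<eta>1 F C(2)]
      Jcost_eq_path_functional[OF \<eta>2 F C(1)] Jcost_eq_path_functional[OF \<eta>2 F C(2)]
    by simp
qed

section \<open>Monotonicity gaps and equality of the couplings\<close>

text \<open>Strict monotonicity for the marginals at time t, with the integrals transported to the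
  space of curves.\<close>

lemma monotone_gap:
  assumes \<eta>1: "\<eta>1 \<in> Pcurves \<Omega> T" and \<eta>2: "\<eta>2 \<in> Pcurves \<Omega> T"
    and H: "cont_on_OmegaP \<Omega> H" "strictly_monotone \<Omega> H"
  defines "k \<equiv> \<lambda>t x. H x (mflow \<Omega> \<eta>1 t) - H x (mflow \<Omega> \<eta>2 t)"
  shows "0 \<le> (\<integral>\<gamma>. k t (\<gamma> t) \<partial>\<eta>1) - (\<integral>\<gamma>. k t (\<gamma> t) \<partial>\<eta>2)"
    and "(\<integral>\<gamma>. k t (\<gamma> t) \<partial>\<eta>1) - (\<integral>\<gamma>. k t (\<gamma> t) \<partial>\<eta>2) = 0 \<Longrightarrow> x \<in> closure \<Omega> \<Longrightarrow>
      H x (mflow \<Omega> \<eta>1 t) = H x (mflow \<Omega> \<eta>2 t)"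
proof -
  have "continuous_on (closure \<Omega>) (k t)"
    unfolding k_def
    using running_continuous_space[OF continuous_along_mflow[OF \<eta>1 H(1)], of t]
      running_continuous_space[OF continuous_along_mflow[OF \<eta>2 H(1)], of t]
    by (intro continuous_on_diff) auto
  note * = mflow_integral[OF \<eta>1 this, of t] mflow_integral[OF \<eta>2 this, of t]
  have "let I = (\<integral>\<gamma>. k t (\<gamma> t) \<partial>\<eta>1) - (\<integral>\<gamma>. k t (\<gamma> t) \<partial>\<eta>2)
    in I \<ge> 0 \<and> (I = 0 \<longleftrightarrow> (\<forall>x\<in>closure \<Omega>. H x (mflow \<Omega> \<eta>1 t) = H x (mflow \<Omega> \<eta>2 t)))"
    using H(2) mflow_Pmeas[OF \<eta>1, of t] mflow_Pmeas[OF \<eta>2, of t] *[symmetric]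
    unfolding strictly_monotone_def k_def by simp
  then show "0 \<le> (\<integral>\<gamma>. k t (\<gamma> t) \<partial>\<eta>1) - (\<integral>\<gamma>. k t (\<gamma> t) \<partial>\<eta>2)"
    "(\<integral>\<gamma>. k t (\<gamma> t) \<partial>\<eta>1) - (\<integral>\<gamma>. k t (\<gamma> t) \<partial>\<eta>2) = 0 \<Longrightarrow> x \<in> closure \<Omega> \<Longrightarrow>
      H x (mflow \<Omega> \<eta>1 t) = H x (mflow \<Omega> \<eta>2 t)"
    unfolding Let_def by blast+
qed

lemma equilibria_couplings_eq:
  assumes F: "cont_on_OmegaP \<Omega> F" "strictly_monotone \<Omega> F"
    and G: "cont_on_OmegaP \<Omega> G" "strictly_monotone \<Omega> G"
    and eq1: "MFG_equilibrium \<Omega> L F G T m0 \<eta>1" and eq2: "MFG_equilibrium \<Omega> L F G T m0 \<eta>2"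
    and x: "x \<in> closure \<Omega>"
  shows "t \<in> {0..T} \<Longrightarrow> F x (mflow \<Omega> \<eta>1 t) = F x (mflow \<Omega> \<eta>2 t)"
    and "G x (mflow \<Omega> \<eta>1 T) = G x (mflow \<Omega> \<eta>2 T)"
proof -
  have \<eta>1: "\<eta>1 \<in> Pcurves \<Omega> T" and \<eta>2: "\<eta>2 \<in> Pcurves \<Omega> T"
    and start: "mflow \<Omega> \<eta>1 0 = mflow \<Omega> \<eta>2 0"
    using eq1 eq2 by (auto simp: MFG_equilibrium_def Pm0curves_def)
  define h where "h t x = F x (mflow \<Omega> \<eta>1 t) - F x (mflow \<Omega> \<eta>2 t)" for t x
  \<comment> \<open>The time variable is kept so that continuity along the flow applies before
    specialising to \<open>T\<close>.\<close>
  define g where "g t x = G x (mflow \<Omega> \<eta>1 t) - G x (mflow \<Omega> \<eta>2 t)" for t x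
  have ch: "continuous_on (UNIV \<times> closure \<Omega>) (\<lambda>(t,x). h t x)"
    using continuous_on_diff[OF continuous_along_mflow[OF \<eta>1 F(1)] continuous_along_mflow[OF \<eta>2 F(1)]]
    by (simp add: h_def case_prod_beta)
  have "continuous_on (UNIV \<times> closure \<Omega>) (\<lambda>(t,x). g t x)"
    using continuous_on_diff[OF continuous_along_mflow[OF \<eta>1 G(1)] continuous_along_mflow[OF \<eta>2 G(1)]]
    by (simp add: g_def case_prod_beta)
  then have cg: "continuous_on (closure \<Omega>) (g T)"
    by (rule running_continuous_space)
  let ?D = "path_functional h (g T)"
  obtain M where M: "\<And>\<gamma>. \<gamma> \<in> Curves \<Omega> T \<Longrightarrow> \<bar>?D \<gamma>\<bar> \<le> M"
    by (rule path_functional_bound[OF ch cg]) blast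
  have "(\<integral>\<gamma>. ?D \<gamma> \<partial>\<eta>1) \<le> (\<integral>\<gamma>. ?D \<gamma> \<partial>\<eta>2)"
  proof (rule integral_le_by_start_points[OF \<eta>1 \<eta>2 start M path_functional_continuous[OF ch cg]])
    fix \<gamma>1 \<gamma>2 assume *: "\<gamma>1 \<in> support_curves \<Omega> T \<eta>1" "\<gamma>2 \<in> support_curves \<Omega> T \<eta>2" "\<gamma>1 0 = \<gamma>2 0"
    then have "\<gamma>1 \<in> optimal_curves \<Omega> L F G T \<eta>1 (\<gamma>1 0)" "\<gamma>2 \<in> optimal_curves \<Omega> L F G T \<eta>2 (\<gamma>2 0)"
      using eq1 eq2 by (auto simp: MFG_equilibrium_def optimal_curves_def)
    then show "?D \<gamma>1 \<le> ?D \<gamma>2"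
      using optimal_exchange[OF \<eta>1 \<eta>2 F(1), of \<gamma>1 L G "\<gamma>1 0" \<gamma>2] *(3) unfolding h_def g_def by simp
  qed
  \<comment> \<open>\<Phi> is the gap of \<open>F\<close> at time t, and \<Psi> below is the gap of
    \<open>G\<close> at the final time.\<close>
  define \<Phi> where "\<Phi> t = (\<integral>\<gamma>. h t (\<gamma> t) \<partial>\<eta>1) - (\<integral>\<gamma>. h t (\<gamma> t) \<partial>\<eta>2)" for t
  define \<Psi> where "\<Psi> = (\<integral>\<gamma>. g T (\<gamma> T) \<partial>\<eta>1) - (\<integral>\<gamma>. g T (\<gamma> T) \<partial>\<eta>2)"
  note c = mean_running_continuous[OF ch \<eta>1] mean_running_continuous[OF ch \<eta>2]
  have c\<Phi>: "continuous_on {0..T} \<Phi>"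
    unfolding \<Phi>_def by (intro continuous_on_diff c)
  have \<Phi>_nonneg: "0 \<le> \<Phi> t" for t
    unfolding \<Phi>_def h_def by (rule monotone_gap(1)[OF \<eta>1 \<eta>2 F])
  have \<Psi>_nonneg: "0 \<le> \<Psi>"
    unfolding \<Psi>_def g_def by (rule monotone_gap(1)[OF \<eta>1 \<eta>2 G])
  have "(\<integral>\<gamma>. ?D \<gamma> \<partial>\<eta>1) - (\<integral>\<gamma>. ?D \<gamma> \<partial>\<eta>2) = (LINT t:{0..T}|lborel. \<Phi> t) + \<Psi>"
    unfolding path_functional_integral[OF ch cg \<eta>1] path_functional_integral[OF ch cg \<eta>2] \<Phi>_def \<Psi>_def
    using borel_integrable_atLeastAtMost'[OF c(1)] borel_integrable_atLeastAtMost'[OF c(2)]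
    by (simp add: set_integral_diff(2))
  moreover have "(LINT t:{0..T}|lborel. \<Phi> t) = integral {0..T} \<Phi>"
    by (rule set_borel_integral_eq_integral(2)[OF borel_integrable_atLeastAtMost'[OF c\<Phi>]])
  moreover have "0 \<le> integral {0..T} \<Phi>"
    using \<Phi>_nonneg integrable_continuous_interval[OF c\<Phi>] by (intro Henstock_Kurzweil_Integration.integral_nonneg) auto
  \<comment> \<open>The sum of the two nonnegative terms is at most zero by the comparison of
    integrals.\<close>
  ultimately have zero: "integral {0..T} \<Phi> = 0" "\<Psi> = 0"
    using \<open>(\<integral>\<gamma>. ?D \<gamma> \<partial>\<eta>1) \<le> (\<integral>\<gamma>. ?D \<gamma> \<partial>\<eta>2)\<close> \<Psi>_nonneg by linarith+
  \<comment> \<open>A nonnegative continuous function with zero integral vanishes at every point of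
    [0,T], not merely almost everywhere.\<close>
  have \<Phi>0: "\<Phi> t = 0" if "t \<in> {0..T}" for t
    using integral_eq_0_iff[OF c\<Phi> T_pos \<Phi>_nonneg] zero(1) that by blast
  show "F x (mflow \<Omega> \<eta>1 t) = F x (mflow \<Omega> \<eta>2 t)" if "t \<in> {0..T}"
    using monotone_gap(2)[OF \<eta>1 \<eta>2 F _ x] \<Phi>0[OF that] unfolding \<Phi>_def h_def .
  show "G x (mflow \<Omega> \<eta>1 T) = G x (mflow \<Omega> \<eta>2 T)"
    using monotone_gap(2)[OF \<eta>1 \<eta>2 G _ x] zero(2) unfolding \<Psi>_def g_def .
qed

end

section \<open>Equality of the costs and of the value functions\<close>

text \<open>The flows enter only through the couplings along the curve. Equality of the integrands
  cut off by the indicator settles both the branch of \<open>eint\<close> and the value of the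
  integral.\<close>

lemma cost_from_cong:
  assumes "\<And>s. s \<in> {t..T} \<Longrightarrow> F (\<gamma> s) (m1 s) = F (\<gamma> s) (m2 s)" "G (\<gamma> T) (m1 T) = G (\<gamma> T) (m2 T)"
  shows "cost_from L F G T m1 t \<gamma> = cost_from L F G T m2 t \<gamma>"
proof -
  have "indicator {t..T} s *\<^sub>R (L (\<gamma> s) (vector_derivative \<gamma> (at s)) + F (\<gamma> s) (m1 s)) =
      indicator {t..T} s *\<^sub>R (L (\<gamma> s) (vector_derivative \<gamma> (at s)) + F (\<gamma> s) (m2 s))" for s
    using assms(1) by (cases "s \<in> {t..T}") auto
  then show ?thesis
    unfolding cost_from_def eint_def set_integrable_def set_lebesgue_integral_def assms(2) by presburger
qed

theorem theorem4p1:
  fixes \<Omega> :: "'a::euclidean_space set"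
    and T :: real
    and m0 :: "'a measure"
    and L :: "'a \<Rightarrow> 'a \<Rightarrow> real"
    and F G :: "'a \<Rightarrow> 'a measure \<Rightarrow> real"
    and \<eta>1 \<eta>2 :: "(real \<Rightarrow> 'a) measure"
  assumes "bounded \<Omega>" and "open \<Omega>" and "C2_boundary \<Omega>"
    and "T > 0"
    and "m0 \<in> Pmeas \<Omega>"
    and "Lagrangian_ok \<Omega> L"
    and "cont_on_OmegaP \<Omega> F" and "cont_on_OmegaP \<Omega> G"
    and "strictly_monotone \<Omega> F" and "strictly_monotone \<Omega> G"
    and "MFG_equilibrium \<Omega> L F G T m0 \<eta>1"
    and "MFG_equilibrium \<Omega> L F G T m0 \<eta>2"
  shows "(\<forall>\<gamma>\<in>Curves \<Omega> T. Jcost \<Omega> L F G T \<eta>1 \<gamma> = Jcost \<Omega> L F G T \<eta>2 \<gamma>) \<and>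
         (\<forall>u1 m1 u2 m2. mild_solution \<Omega> L F G T m0 u1 m1 \<and> mild_solution \<Omega> L F G T m0 u2 m2
            \<longrightarrow> (\<forall>t\<in>{0..T}. \<forall>x\<in>closure \<Omega>. u1 t x = u2 t x))"
proof -
  interpret curve_space \<Omega> T
    by unfold_locales fact+
  \<comment> \<open>Stated for any two equilibria and any initial time: it serves \<eta>1 and
    \<eta>2 at time 0, and also the equilibria behind two mild solutions, which may be different
    ones.\<close>
  have cost_eq: "cost_from L F G T m1 t \<gamma> = cost_from L F G T m2 t \<gamma>"
    if eq: "MFG_equilibrium \<Omega> L F G T m0 \<eta>" "MFG_equilibrium \<Omega> L F G T m0 \<eta>'"
      and m: "\<And>s. s \<in> {0..T} \<Longrightarrow> m1 s = mflow \<Omega> \<eta> s" "\<And>s. s \<in> {0..T} \<Longrightarrow> m2 s = mflow \<Omega> \<eta>' s"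
      and t: "t \<in> {0..T}" and \<gamma>: "\<gamma> \<in> Curves \<Omega> T"
    for \<eta> \<eta>' m1 m2 t \<gamma>
  proof (rule cost_from_cong)
    note couplings = equilibria_couplings_eq[OF assms(7,9,8,10) eq curve_mem[OF \<gamma>]]
    show "F (\<gamma> s) (m1 s) = F (\<gamma> s) (m2 s)" if "s \<in> {t..T}" for s
      using couplings(1)[of s s] m[of s] that t by simp
    show "G (\<gamma> T) (m1 T) = G (\<gamma> T) (m2 T)"
      using couplings(2)[of T] m[of T] T_pos by simp
  qed
  show ?thesis
  proof (intro conjI ballI allI impI)
    fix \<gamma> assume "\<gamma> \<in> Curves \<Omega> T"
    then show "Jcost \<Omega> L F G T \<eta>1 \<gamma> = Jcost \<Omega> L F G T \<eta>2 \<gamma>"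
      unfolding Jcost_def using T_pos by (intro cost_eq[OF assms(11,12)]) auto
  next
    fix u1 m1 u2 m2 t x
    assume mild: "mild_solution \<Omega> L F G T m0 u1 m1 \<and> mild_solution \<Omega> L F G T m0 u2 m2"
      and t: "t \<in> {0..T}" and x: "x \<in> closure \<Omega>"
    from mild obtain \<eta> where \<eta>: "MFG_equilibrium \<Omega> L F G T m0 \<eta>" "\<forall>t\<in>{0..T}. m1 t = mflow \<Omega> \<eta> t"
      and u1: "\<forall>t\<in>{0..T}. \<forall>x\<in>closure \<Omega>.
        ereal (u1 t x) = (INF \<gamma>\<in>{\<gamma>\<in>Curves \<Omega> T. \<gamma> t = x}. cost_from L F G T m1 t \<gamma>)"
      unfolding mild_solution_def by blast
    from mild obtain \<eta>' where \<eta>': "MFG_equilibrium \<Omega> L F G T m0 \<eta>'" "\<forall>t\<in>{0..T}. m2 t = mflow \<Omega> \<eta>' t"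
      and u2: "\<forall>t\<in>{0..T}. \<forall>x\<in>closure \<Omega>.
        ereal (u2 t x) = (INF \<gamma>\<in>{\<gamma>\<in>Curves \<Omega> T. \<gamma> t = x}. cost_from L F G T m2 t \<gamma>)"
      unfolding mild_solution_def by blast
    \<comment> \<open>Both values are infima over the same set of curves, with equal costs on each
      of them.\<close>
    have "ereal (u1 t x) = (INF \<gamma>\<in>{\<gamma>\<in>Curves \<Omega> T. \<gamma> t = x}. cost_from L F G T m1 t \<gamma>)"
      using u1 t x by blast
    also have "\<dots> = (INF \<gamma>\<in>{\<gamma>\<in>Curves \<Omega> T. \<gamma> t = x}. cost_from L F G T m2 t \<gamma>)"
      using \<eta>(2) \<eta>'(2) t by (intro INF_cong refl cost_eq[OF \<eta>(1) \<eta>'(1)]) auto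
    also have "\<dots> = ereal (u2 t x)"
      using u2 t x by simp
    finally show "u1 t x = u2 t x" by simp
  qed
qed

end
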